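(* Let $\beta>1$ be a quadratic integer whose conjugate $\beta'$ satisfies $\beta'>\beta$. Then each $\xi\in\mathbb{Q}(\beta)$ such that $\xi>\beta$ and $\xi'\in(-1,0)$ has an aperiodic $\beta$-continued fraction expansion, i.e. an expansion that is infinite and not eventually periodic. In particular, $\beta$ satisfies neither property (CFF) nor property (CFP).
   Context: A quadratic integer is an algebraic integer of degree 2. For $x\in\mathbb{Q}(\beta)$, $x'$ denotes its image under the non-trivial automorphism of $\mathbb{Q}(\beta)$. $\beta$-integers: for real $\beta>1$, every real $x\ge 0$ has a unique (up to leading zeros) greedy $\beta$-expansion $x=\sum_{i=-\infty}^{k}x_i\beta^i$ with integer digits $0\le x_i<\beta$ such that $\sum_{i=-\infty}^{j}x_i\beta^i<\beta^{j+1}$ for every $j\le k$. The set $\mathbb{Z}_\beta$ of $\beta$-integers consists of all real $x$ such that the greedy $\beta$-expansion of $|x|$ has $x_i=0$ for all $i<0$. $\beta$-continued fraction of $\xi\in\mathbb{R}$: put $\xi_0=\xi$ and, for $n\ge 0$, $a_n=\max\{y\in\mathbb{Z}_\beta: y\le \xi_n\}$; if $\xi_n\in\mathbb{Z}_\beta$ the algorithm stops and the expansion $[a_0,\dots,a_n]$ is finite; otherwise $\xi_{n+1}=1/(\xi_n-a_n)$. If it never stops, the expansion is the infinite sequence $[a_0,a_1,\dotsc]$. Property (CFF): every element of $\mathbb{Q}(\beta)$ has a finite $\beta$-continued fraction expansion. Property (CFP): every element of $\mathbb{Q}(\beta)$ has a finite or eventually periodic $\beta$-continued fraction expansion. *)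

theory Defs
  imports "HOL-Analysis.Analysis" "HOL-Computational_Algebra.Polynomial"
begin

section \<open>Quadratic integers and conjugation\<close>

(* The degree of an algebraic number, i.e. the degree of its minimal polynomial over the
   rationals; meaningful only if x is algebraic. *)
definition alg_degree :: "real \<Rightarrow> nat" where
  "alg_degree x =
     (LEAST n. \<exists>p::rat poly. p \<noteq> 0 \<and> degree p = n \<and> poly (map_poly of_rat p) x = 0)"

definition quadratic_integer :: "real \<Rightarrow> bool" where
  "quadratic_integer x \<longleftrightarrow> algebraic_int x \<and> alg_degree x = 2"

definition real_subfield :: "real set \<Rightarrow> bool" where
  "real_subfield K \<longleftrightarrow> 0 \<in> K \<and> 1 \<in> K \<and>
     (\<forall>x\<in>K. \<forall>y\<in>K. x + y \<in> K \<and> x * y \<in> K) \<and>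
     (\<forall>x\<in>K. - x \<in> K \<and> inverse x \<in> K)"

(* The field generated by b over the rationals: every subfield of the reals contains the
   rationals, so this is the smallest subfield of the reals containing b. *)
definition rat_adjoin :: "real \<Rightarrow> real set" where
  "rat_adjoin b = real_subfield hull {b}"

definition field_automorphism_on :: "real set \<Rightarrow> (real \<Rightarrow> real) \<Rightarrow> bool" where
  "field_automorphism_on K \<sigma> \<longleftrightarrow> bij_betw \<sigma> K K \<and> \<sigma> 1 = 1 \<and>
     (\<forall>x\<in>K. \<forall>y\<in>K. \<sigma> (x + y) = \<sigma> x + \<sigma> y \<and> \<sigma> (x * y) = \<sigma> x * \<sigma> y)"

(* The image of x under the non-trivial automorphism of the field generated by b. For b of
   degree 2 and x in that field this value exists and is unique; for other b or x it is
   unspecified. *)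
definition quad_conj :: "real \<Rightarrow> real \<Rightarrow> real" where
  "quad_conj b x =
     (THE y. \<exists>\<sigma>. field_automorphism_on (rat_adjoin b) \<sigma> \<and>
                 (\<exists>z\<in>rat_adjoin b. \<sigma> z \<noteq> z) \<and> y = \<sigma> x)"

section \<open>Beta-integers\<close>

(* d is the digit sequence of the greedy expansion of x in base b: d i is the coefficient of
   the i-th power of b, and the digits above some index k are the leading zeros. The terms are
   non-negative, so the unconditional sums over {..j} are the usual series. *)
definition greedy_expansion :: "real \<Rightarrow> real \<Rightarrow> (int \<Rightarrow> int) \<Rightarrow> bool" where
  "greedy_expansion b x d \<longleftrightarrow>
     (\<forall>i. 0 \<le> d i \<and> of_int (d i) < b) \<and>
     (\<exists>k. (\<forall>i>k. d i = 0) \<and>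
          ((\<lambda>i. of_int (d i) * b powi i) has_sum x) {..k} \<and>
          (\<forall>j\<le>k. (\<Sum>\<^sub>\<infinity>i\<in>{..j}. of_int (d i) * b powi i) < b powi (j + 1)))"

(* The greedy expansion of a non-negative real is unique, so the existential quantifier
   speaks about the greedy expansion of the absolute value of x. *)
definition beta_integers :: "real \<Rightarrow> real set" where
  "beta_integers b = {x. \<exists>d. greedy_expansion b \<bar>x\<bar> d \<and> (\<forall>i<0. d i = 0)}"

section \<open>Beta-continued fractions\<close>

definition beta_floor :: "real \<Rightarrow> real \<Rightarrow> real" where
  "beta_floor b x = (GREATEST y. y \<in> beta_integers b \<and> y \<le> x)"

(* The n-th complete quotient of x; None once the algorithm has stopped before step n. *)
primrec bcf_quotient :: "real \<Rightarrow> real \<Rightarrow> nat \<Rightarrow> real option" where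
  "bcf_quotient b x 0 = Some x"
| "bcf_quotient b x (Suc n) =
     (case bcf_quotient b x n of
        None \<Rightarrow> None
      | Some y \<Rightarrow> if y \<in> beta_integers b then None else Some (1 / (y - beta_floor b y)))"

definition bcf_digit :: "real \<Rightarrow> real \<Rightarrow> nat \<Rightarrow> real option" where
  "bcf_digit b x n = map_option (beta_floor b) (bcf_quotient b x n)"

definition bcf_finite :: "real \<Rightarrow> real \<Rightarrow> bool" where
  "bcf_finite b x \<longleftrightarrow> (\<exists>n. bcf_digit b x n = None)"

definition bcf_eventually_periodic :: "real \<Rightarrow> real \<Rightarrow> bool" where
  "bcf_eventually_periodic b x \<longleftrightarrow> \<not> bcf_finite b x \<and>
     (\<exists>p>0. \<exists>N. \<forall>n\<ge>N. bcf_digit b x (n + p) = bcf_digit b x n)"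

definition bcf_aperiodic :: "real \<Rightarrow> real \<Rightarrow> bool" where
  "bcf_aperiodic b x \<longleftrightarrow> \<not> bcf_finite b x \<and> \<not> bcf_eventually_periodic b x"

definition CFF :: "real \<Rightarrow> bool" where
  "CFF b \<longleftrightarrow> (\<forall>x\<in>rat_adjoin b. bcf_finite b x)"

definition CFP :: "real \<Rightarrow> bool" where
  "CFP b \<longleftrightarrow> (\<forall>x\<in>rat_adjoin b. bcf_finite b x \<or> bcf_eventually_periodic b x)"

end

theory Submission
  imports Defs
begin

text \<open>
  Write \<open>x'\<close> for the conjugate of \<open>x\<close>, and let \<open>x\<^sub>n\<close> and \<open>a\<^sub>n\<close> be the complete and the partial
  quotients of \<open>\<xi>\<close>. Since \<open>\<beta>' > \<beta> > 1\<close> and digits are non-negative, conjugation does not decrease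
  a non-negative \<open>\<beta>\<close>-integer \<open>y\<close>. Moreover \<open>y' = y\<close> only if \<open>y\<close> consists of its lowest digit and
  so is an ordinary integer below \<open>\<beta>\<close>; every other \<open>y\<close> has \<open>y' \<ge> \<beta>'\<close> (lemma
  \<open>beta_integer_conj\<close>).

  Infinity of the expansion: the conditions \<open>x\<^sub>n > 1\<close> and \<open>-1 < x\<^sub>n' < 0\<close> pass from \<open>x\<^sub>n\<close> to
  \<open>x\<^sub>n\<^sub>+\<^sub>1 = 1 / (x\<^sub>n - a\<^sub>n)\<close>, because \<open>a\<^sub>n' \<ge> a\<^sub>n \<ge> 1\<close> and \<open>x\<^sub>n - a\<^sub>n < 1\<close>. A positive number with
  negative conjugate is not a \<open>\<beta>\<close>-integer, so the algorithm never stops (\<open>reduced_step\<close>).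

  Aperiodicity: suppose that the partial quotients have period \<open>p\<close> from some index on. A continued
  fraction with real partial quotients \<open>\<ge> 1\<close> determines its value
  (\<open>complete_quotient_unique\<close>), so the complete quotients have period \<open>p\<close> too. Let \<open>M\<close> be the product
  of the matrices with rows \<open>(a\<^sub>n, 1)\<close> and \<open>(1, 0)\<close> over one period. It has an eigenvalue \<open>e\<close> in
  \<open>\<rat>(\<beta>)\<close>, its determinant \<open>d\<close> is \<open>\<plusminus>1\<close>, and its trace \<open>T = e + d / e\<close> lies in \<open>\<int>[\<beta>]\<close>; hence \<open>e\<close> is
  a unit of the ring of integers and its norm \<open>e e'\<close> is \<open>\<plusminus>1\<close> (\<open>norm_of_unit\<close>). Thus
  \<open>T' = e' + d / e' = \<plusminus>T\<close>. But \<open>T\<close> is an increasing function of the partial quotients, and these do not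
  decrease under conjugation; so \<open>T' = T\<close>, and every \<open>a\<^sub>n\<close> in the period equals its conjugate
  (\<open>conj_fixes_periodic_partial_quotients\<close>). The periodic part therefore consists of ordinary
  integers below \<open>\<beta>\<close>.

  It remains to go backwards. The conjugated recursion \<open>x\<^sub>n' - a\<^sub>n' = 1 / x\<^sub>n\<^sub>+\<^sub>1'\<close> with
  \<open>-1 < x\<^sub>n' < 0\<close> almost determines \<open>a\<^sub>n'\<close> from \<open>x\<^sub>n\<^sub>+\<^sub>1\<close>. If \<open>x\<close> is periodic with rational partial
  quotients from index \<open>n + 1\<close> on, then \<open>a\<^sub>n'\<close> and the integer \<open>a\<^sub>n\<^sub>+\<^sub>p < \<beta>\<close> differ by less than \<open>1\<close>. As
  \<open>\<beta>' > \<beta> + 1\<close> (\<open>conj_gap\<close>, because the discriminant is an integer that is not a square), \<open>a\<^sub>n' < \<beta>'\<close>,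
  so \<open>a\<^sub>n\<close> is an ordinary integer as well, and equal to \<open>a\<^sub>n\<^sub>+\<^sub>p\<close>. In this way all partial quotients are
  integers below \<open>\<beta>\<close>, whereas \<open>\<xi> > \<beta>\<close> forces \<open>a\<^sub>0 \<ge> \<beta>\<close>.

  Both finiteness properties fail because numbers \<open>\<xi>\<close> of the required kind exist: round
  \<open>m \<beta>'\<close> down to an integer \<open>z\<close> and take \<open>z - m \<beta>\<close> with \<open>m\<close> large (\<open>ex_reduced_gt_base\<close>).
\<close>

section \<open>The minimal equation of a quadratic integer\<close>

lemma quadratic_integer_irrational:
  assumes "quadratic_integer \<beta>"
  shows "\<beta> \<notin> \<rat>"
proof
  assume "\<beta> \<in> \<rat>"
  then obtain r where r: "\<beta> = of_rat r" by (auto elim: Rats_cases)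
  have "\<exists>p::rat poly. p \<noteq> 0 \<and> degree p = 1 \<and> poly (map_poly of_rat p) \<beta> = 0"
    by (rule exI[of _ "[:-r, 1:]"]) (simp add: r map_poly_pCons of_rat_minus)
  then have "alg_degree \<beta> \<le> 1" unfolding alg_degree_def by (rule Least_le)
  then show False using assms by (simp add: quadratic_integer_def)
qed

lemma quadratic_integer_int_root:
  assumes "quadratic_integer \<beta>"
  shows "\<exists>M::int poly. degree M = 2 \<and> poly (map_poly of_int M) \<beta> = 0"
proof -
  let ?root = "\<lambda>n. \<exists>p::rat poly. p \<noteq> 0 \<and> degree p = n \<and> poly (map_poly of_rat p) \<beta> = 0"
  have alg: "algebraic_int \<beta>" and deg: "alg_degree \<beta> = 2"
    using assms by (auto simp: quadratic_integer_def)
  from alg obtain P :: "int poly" where P: "poly (map_poly of_int P) \<beta> = 0" "lead_coeff P = 1"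
    by (auto simp: algebraic_int_altdef_ipoly)
  have "map_poly of_rat (map_poly of_int P :: rat poly) = (map_poly of_int P :: real poly)"
    by (simp add: map_poly_map_poly o_def)
  moreover have "(map_poly of_int P :: rat poly) \<noteq> 0"
    using P(2) by (subst map_poly_eq_0_iff) auto
  ultimately have "\<exists>n. ?root n"
    using P(1) by (metis (no_types, lifting))
  then have "?root (alg_degree \<beta>)" unfolding alg_degree_def by (rule LeastI_ex)
  then obtain p :: "rat poly" where p: "degree p = 2" "poly (map_poly of_rat p) \<beta> = 0"
    by (auto simp: deg)
  let ?q = "map_poly of_rat p :: real poly"
  have q2: "degree ?q = 2" by (subst degree_map_poly) (auto simp: p)
  \<comment> \<open>A common denominator of the three coefficients.\<close>
  define m where "m = (\<Prod>i\<le>2. snd (quotient_of (coeff p i)))"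
  have m0: "m > 0" unfolding m_def by (intro prod_pos) (simp add: quotient_of_denom_pos')
  have int: "\<exists>z. of_int z = of_int m * coeff p i" if "i \<le> 2" for i
  proof -
    obtain a b where ab: "quotient_of (coeff p i) = (a, b)" by force
    have b: "b > 0" using ab quotient_of_denom_pos by blast
    have "snd (quotient_of (coeff p i)) dvd m"
      unfolding m_def by (rule dvd_prodI) (use that in auto)
    then obtain c where "m = b * c" using ab by (auto elim: dvdE)
    moreover have "coeff p i = of_int a / of_int b" using quotient_of_div[OF ab] .
    ultimately have "of_int (c * a) = of_int m * coeff p i" using b by simp
    then show ?thesis by blast
  qed
  then obtain z where z: "\<And>i. i \<le> 2 \<Longrightarrow> of_int (z i) = of_int m * coeff p i" by metis
  define M where "M = [:z 0, z 1, z 2:]"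
  have "z 2 \<noteq> 0"
  proof
    assume "z 2 = 0"
    then have "coeff p 2 = 0" using z[of 2] m0 by simp
    then show False using p(1) by (metis leading_coeff_0_iff degree_0 zero_neq_numeral)
  qed
  then have "degree M = 2" by (simp add: M_def)
  moreover have "poly (map_poly of_int M) \<beta> = 0"
  proof -
    have zr: "real_of_int (z i) = real_of_int m * of_rat (coeff p i)" if "i \<le> 2" for i
    proof -
      have "real_of_int (z i) = of_rat (of_int (z i))" by simp
      then show ?thesis using z[OF that] by (simp add: of_rat_mult)
    qed
    have "poly ?q \<beta> = (\<Sum>i\<le>2. of_rat (coeff p i) * \<beta> ^ i)"
      by (simp add: poly_altdef q2 coeff_map_poly)
    also have "\<dots> = of_rat (coeff p 0) + of_rat (coeff p 1) * \<beta> + of_rat (coeff p 2) * (\<beta> * \<beta>)"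
      by (simp add: numeral_2_eq_2)
    finally have e: "of_rat (coeff p 0) + of_rat (coeff p 1) * \<beta> + of_rat (coeff p 2) * (\<beta> * \<beta>) = 0"
      using p(2) by simp
    have "poly (map_poly of_int M) \<beta> = of_int (z 0) + of_int (z 1) * \<beta> + of_int (z 2) * (\<beta> * \<beta>)"
      by (simp add: M_def map_poly_pCons algebra_simps)
    also have "\<dots> = of_int m * (of_rat (coeff p 0) + of_rat (coeff p 1) * \<beta>
                                   + of_rat (coeff p 2) * (\<beta> * \<beta>))"
      by (simp add: zr algebra_simps)
    finally show ?thesis using e by simp
  qed
  ultimately show ?thesis by blast
qed

lemma map_poly_of_int_mult:
  "map_poly of_int (p * q) = (map_poly of_int p * map_poly of_int q :: real poly)"
  by (rule poly_eqI) (simp add: coeff_map_poly coeff_mult)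

lemma map_poly_of_int_add:
  "map_poly of_int (p + q) = (map_poly of_int p + map_poly of_int q :: real poly)"
  by (rule poly_eqI) (simp add: coeff_map_poly)

text \<open>Gauss's lemma for the case at hand. The primitive integer polynomial \<open>M\<close> of degree \<open>2\<close> with
  root \<open>\<beta>\<close> divides, up to a constant factor \<open>a\<close>, a monic integer polynomial \<open>P\<close> with root \<open>\<beta>\<close>.
  Contents are multiplicative, so \<open>a\<close> cancels, and the leading coefficient of \<open>M\<close> divides that
  of \<open>P\<close>.\<close>

lemma quadratic_integer_monic:
  assumes "quadratic_integer \<beta>"
  shows "\<exists>t n. \<beta> * \<beta> = of_int t * \<beta> - of_int n"
proof -
  let ?ev = "\<lambda>p::int poly. poly (map_poly of_int p) \<beta>"
  have ev_mult: "?ev (p * q) = ?ev p * ?ev q" for p q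
    by (simp add: map_poly_of_int_mult)
  have ev_add: "?ev (p + q) = ?ev p + ?ev q" for p q
    by (simp add: map_poly_of_int_add)
  have ev_smult: "?ev (smult c p) = of_int c * ?ev p" for c p
    using ev_mult[of "[:c:]" p] by (simp add: map_poly_pCons)
  have irr: "\<beta> \<notin> \<rat>" using assms by (rule quadratic_integer_irrational)
  from assms obtain P :: "int poly" where P: "?ev P = 0" "lead_coeff P = 1"
    by (auto simp: algebraic_int_altdef_ipoly quadratic_integer_def)
  obtain M0 :: "int poly" where M0: "degree M0 = 2" "?ev M0 = 0"
    using quadratic_integer_int_root[OF assms] by blast
  define M where "M = primitive_part M0"
  have M0_0: "M0 \<noteq> 0" using M0(1) by auto
  have degM: "degree M = 2" using M0 by (simp add: M_def)
  have contM: "content M = 1" using M0_0 by (simp add: M_def)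
  have evM: "?ev M = 0"
    using M0 M0_0 ev_smult[of "content M0" M] by (auto simp: M_def)
  have "M \<noteq> 0" using degM by auto
  then obtain a q where a: "a \<noteq> 0" and aq: "smult a P = M * q + pseudo_mod P M"
    and r: "pseudo_mod P M = 0 \<or> degree (pseudo_mod P M) < degree M"
    using pseudo_mod[of M P] by blast
  define R where "R = pseudo_mod P M"
  \<comment> \<open>The remainder is linear at most and has the irrational root \<open>\<beta>\<close>, so it vanishes.\<close>
  have "degree R \<le> 1" using r degM by (auto simp: R_def)
  then obtain c0 c1 where R: "R = [:c0, c1:]"
    by (metis One_nat_def degree0_coeffs degree1_coeffs le_Suc_eq le_zero_eq pCons_0_0)
  have "?ev R = 0" using arg_cong[OF aq, of ?ev] P evM
    by (simp add: ev_mult ev_add ev_smult flip: R_def)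
  then have c: "of_int c0 + of_int c1 * \<beta> = 0" by (simp add: R map_poly_pCons mult.commute)
  have "c1 = 0"
  proof (rule ccontr)
    assume "c1 \<noteq> 0"
    then have "\<beta> = - of_int c0 / of_int c1" using c by (simp add: field_simps)
    then show False using irr by (metis Rats_divide Rats_minus_iff Rats_of_int)
  qed
  then have "R = 0" using c R by simp
  then have aq: "smult a P = M * q" using aq by (simp add: R_def)
  have "content P dvd lead_coeff P" by (rule content_dvd_coeff)
  then have "is_unit (content P)" using P(2) by simp
  then have "content P = 1" by (simp only: is_unit_content_iff)
  then have "content q = normalize a"
    using arg_cong[OF aq, of content] contM by (simp add: content_mult)
  then have "[:a:] dvd q" by (simp add: const_poly_dvd_iff_dvd_content)
  then obtain q' where "q = smult a q'" by (auto elim!: dvdE)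
  then have "smult a P = smult a (M * q')" using aq by simp
  then have "P = M * q'" using a by (metis right_minus_eq smult_diff_right smult_eq_0_iff)
  then have "lead_coeff M * lead_coeff q' = 1" using P(2) by (simp add: lead_coeff_mult)
  then have u: "coeff M 2 * coeff M 2 = 1" using degM
    by (metis abs_mult_self_eq dvd_triv_left mult_1 zdvd1_eq)
  define z where "z = coeff M"
  have "?ev M = (\<Sum>i\<le>2. of_int (coeff M i) * \<beta> ^ i)"
    by (simp add: poly_altdef degree_map_poly degM coeff_map_poly)
  then have e: "of_int (z 0) + of_int (z 1) * \<beta> + of_int (z 2) * (\<beta> * \<beta>) = 0"
    using evM by (simp add: numeral_2_eq_2 z_def)
  have "real_of_int (z 2) * of_int (z 2) = 1"
    using u by (metis of_int_1 of_int_mult z_def)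
  then have "\<beta> * \<beta> = - of_int (z 2) * (of_int (z 0) + of_int (z 1) * \<beta>)"
    using e by algebra
  also have "\<dots> = of_int (- z 2 * z 1) * \<beta> - of_int (z 2 * z 0)"
    by (simp add: algebra_simps)
  finally show ?thesis by blast
qed

section \<open>Conjugation in a real quadratic field\<close>

lemma Ints_root_monic_quadratic:
  fixes m :: real
  assumes "m \<in> \<rat>" "b \<in> \<int>" "c \<in> \<int>" "m * m + b * m + c = 0"
  shows "m \<in> \<int>"
proof (rule rational_algebraic_int_is_int)
  show "algebraic_int m"
    by (rule algebraic_int.intros[of "[:c, b, 1:]"])
      (use assms in \<open>auto simp: coeff_pCons algebra_simps split: nat.splits\<close>)
qed fact

text \<open>The integers \<open>t\<close> and \<open>n\<close> are the trace and the norm of \<open>\<beta>\<close>; the conjugate of \<open>\<beta>\<close> is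
  written \<open>t - \<beta>\<close> throughout.\<close>

locale real_quadratic =
  fixes \<beta> :: real and t n :: int
  assumes irrational: "\<beta> \<notin> \<rat>"
    and minimal_equation: "\<beta> * \<beta> = of_int t * \<beta> - of_int n"
begin

lemma coordinates_unique:
  assumes "r \<in> \<rat>" "s \<in> \<rat>" "r' \<in> \<rat>" "s' \<in> \<rat>" "r + s * \<beta> = r' + s' * \<beta>"
  shows "r = r' \<and> s = s'"
proof -
  have "s = s'"
  proof (rule ccontr)
    assume "s \<noteq> s'"
    then have "\<beta> = (r' - r) / (s - s')" using assms(5) by (simp add: field_simps)
    then show False using irrational assms(1-4) by (metis Rats_divide Rats_diff)
  qed
  then show ?thesis using assms(5) by simp
qed

text \<open>The square of the difference of the two roots is the discriminant, an integer. If it were at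
  most \<open>1\<close>, the difference would be \<open>1\<close> and \<open>\<beta>\<close> rational.\<close>

lemma conj_gap:
  assumes "\<beta> < of_int t - \<beta>"
  shows "\<beta> + 1 < of_int t - \<beta>"
proof (rule ccontr)
  assume "\<not> ?thesis"
  then have le: "of_int t - \<beta> - \<beta> \<le> 1" by simp
  define g where "g = of_int t - \<beta> - \<beta>"
  have g: "0 < g" "g \<le> 1" using assms le by (auto simp: g_def)
  have "g * g = of_int (t * t - 4 * n)"
    using minimal_equation unfolding g_def of_int_diff of_int_mult by (simp add: algebra_simps)
  moreover have "0 < g * g" "g * g \<le> 1" using g by (auto intro: mult_le_one)
  ultimately have "g * g = 1" by (smt (verit) of_int_1 of_int_0 of_int_less_iff of_int_le_iff)
  then have "g = 1" using g by (simp add: square_eq_1_iff)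
  then have "\<beta> = (of_int t - 1) / 2" by (simp add: g_def)
  moreover have "(real_of_int t - 1) / 2 \<in> \<rat>" by simp
  ultimately show False using irrational by metis
qed

lemma conj_nonzero:
  assumes "r \<in> \<rat>" "s \<in> \<rat>" "r + s * \<beta> \<noteq> 0"
  shows "r + s * (of_int t - \<beta>) \<noteq> 0"
proof
  assume "r + s * (of_int t - \<beta>) = 0"
  then have eq: "(r + s * of_int t) + (- s) * \<beta> = 0 + 0 * \<beta>" by (simp add: algebra_simps)
  have "r + s * of_int t = 0 \<and> - s = 0"
    by (rule coordinates_unique[OF _ _ _ _ eq]) (use assms in auto)
  then show False using assms by auto
qed

lemma norm_coordinates:
  "(r + s * \<beta>) * (r + s * (of_int t - \<beta>)) = r * r + r * s * of_int t + s * s * of_int n"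
  using minimal_equation by algebra

lemma rat_adjoin_eq: "rat_adjoin \<beta> = {r + s * \<beta> | r s. r \<in> \<rat> \<and> s \<in> \<rat>}" (is "_ = ?K")
proof
  have "real_subfield ?K"
    unfolding real_subfield_def
  proof (intro conjI ballI)
    show "0 \<in> ?K" by (rule CollectI, rule exI[of _ 0], rule exI[of _ 0]) simp
    show "1 \<in> ?K" by (rule CollectI, rule exI[of _ 1], rule exI[of _ 0]) simp
  next
    fix x y assume "x \<in> ?K" "y \<in> ?K"
    then obtain r s r' s' where x: "x = r + s * \<beta>" "r \<in> \<rat>" "s \<in> \<rat>"
      and y: "y = r' + s' * \<beta>" "r' \<in> \<rat>" "s' \<in> \<rat>" by blast
    have "x + y = (r + r') + (s + s') * \<beta>" by (simp add: x y algebra_simps)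
    then show "x + y \<in> ?K" using x y by (blast intro: Rats_add)
    have "x * y = (r * r' - s * s' * of_int n) + (r * s' + s * r' + s * s' * of_int t) * \<beta>"
      using minimal_equation unfolding x y by algebra
    moreover have "r * r' - s * s' * of_int n \<in> \<rat>" "r * s' + s * r' + s * s' * of_int t \<in> \<rat>"
      using x y by auto
    ultimately show "x * y \<in> ?K" by blast
  next
    fix x assume "x \<in> ?K"
    then obtain r s where x: "x = r + s * \<beta>" "r \<in> \<rat>" "s \<in> \<rat>" by blast
    have "- x = - r + (- s) * \<beta>" by (simp add: x)
    then show "- x \<in> ?K" using x by (blast intro: Rats_minus_iff[THEN iffD2])
    show "inverse x \<in> ?K"
    proof (cases "x = 0")
      case True
      then show ?thesis using \<open>x \<in> ?K\<close> by simp
    next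
      case False
      define N where "N = r * r + r * s * of_int t + s * s * of_int n"
      have N: "x * (r + s * (of_int t - \<beta>)) = N"
        unfolding N_def x by (rule norm_coordinates)
      have "r + s * (of_int t - \<beta>) \<noteq> 0" using conj_nonzero x False by simp
      then have N0: "N \<noteq> 0" using N False by auto
      then have "inverse x = (r + s * (of_int t - \<beta>)) / N"
        using N False by (auto simp: field_simps)
      also have "\<dots> = (r + s * of_int t) / N + (- s / N) * \<beta>"
        using N0 by (simp add: field_simps)
      finally have "inverse x = (r + s * of_int t) / N + (- s / N) * \<beta>" .
      moreover have "(r + s * of_int t) / N \<in> \<rat>" "- s / N \<in> \<rat>"
        using x by (auto simp: N_def)
      ultimately show ?thesis by blast
    qed
  qed
  moreover have "\<beta> \<in> ?K" by (rule CollectI, rule exI[of _ 0], rule exI[of _ 1]) simp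
  ultimately show "rat_adjoin \<beta> \<subseteq> ?K"
    unfolding rat_adjoin_def by (intro hull_minimal) auto
next
  show "?K \<subseteq> rat_adjoin \<beta>"
    unfolding rat_adjoin_def hull_def
  proof (rule Inter_greatest)
    fix F assume "F \<in> {F. real_subfield F \<and> {\<beta>} \<subseteq> F}"
    then have F: "real_subfield F" "\<beta> \<in> F" by auto
    have nat: "of_nat k \<in> F" for k
      by (induction k) (use F in \<open>auto simp: real_subfield_def\<close>)
    have int: "of_int k \<in> F" for k
      by (cases k rule: int_cases2) (use F nat in \<open>auto simp: real_subfield_def\<close>)
    have rat: "r \<in> F" if r: "r \<in> \<rat>" for r
    proof -
      obtain a b where "r = of_int a / of_int b" using r by (auto elim: Rats_cases')
      then show ?thesis using F int by (auto simp: real_subfield_def divide_inverse)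
    qed
    show "?K \<subseteq> F" using F rat by (auto simp: real_subfield_def)
  qed
qed

lemma rat_adjoin_cases:
  assumes "x \<in> rat_adjoin \<beta>"
  obtains r s where "r \<in> \<rat>" "s \<in> \<rat>" "x = r + s * \<beta>"
  using assms by (auto simp: rat_adjoin_eq)

lemma rat_adjoinI [intro]: "r \<in> \<rat> \<Longrightarrow> s \<in> \<rat> \<Longrightarrow> r + s * \<beta> \<in> rat_adjoin \<beta>"
  by (auto simp: rat_adjoin_eq)

lemma real_subfield_rat_adjoin: "real_subfield (rat_adjoin \<beta>)"
  unfolding rat_adjoin_def by (rule hull_in) (auto simp: real_subfield_def)

lemma rat_adjoin_add: "x \<in> rat_adjoin \<beta> \<Longrightarrow> y \<in> rat_adjoin \<beta> \<Longrightarrow> x + y \<in> rat_adjoin \<beta>"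
  and rat_adjoin_mult: "x \<in> rat_adjoin \<beta> \<Longrightarrow> y \<in> rat_adjoin \<beta> \<Longrightarrow> x * y \<in> rat_adjoin \<beta>"
  and rat_adjoin_minus: "x \<in> rat_adjoin \<beta> \<Longrightarrow> - x \<in> rat_adjoin \<beta>"
  and rat_adjoin_inverse: "x \<in> rat_adjoin \<beta> \<Longrightarrow> inverse x \<in> rat_adjoin \<beta>"
  using real_subfield_rat_adjoin by (auto simp: real_subfield_def)

lemma rat_adjoin_diff: "x \<in> rat_adjoin \<beta> \<Longrightarrow> y \<in> rat_adjoin \<beta> \<Longrightarrow> x - y \<in> rat_adjoin \<beta>"
  using rat_adjoin_add[of x "- y"] rat_adjoin_minus by simp

lemma field_automorphism_Rats:
  assumes "field_automorphism_on (rat_adjoin \<beta>) \<sigma>" "r \<in> \<rat>"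
  shows "\<sigma> r = r"
proof -
  have K: "q \<in> rat_adjoin \<beta>" if "q \<in> \<rat>" for q using rat_adjoinI[OF that, of 0] by simp
  have add: "\<sigma> (x + y) = \<sigma> x + \<sigma> y" and mult: "\<sigma> (x * y) = \<sigma> x * \<sigma> y" if "x \<in> \<rat>" "y \<in> \<rat>" for x y
    using assms(1) K that by (auto simp: field_automorphism_on_def)
  have one: "\<sigma> 1 = 1" using assms(1) by (simp add: field_automorphism_on_def)
  have zero: "\<sigma> 0 = 0" using add[of 0 0] by simp
  have nat: "\<sigma> (of_nat k) = of_nat k" for k
    by (induction k) (auto simp: zero one add)
  have neg: "\<sigma> (- x) = - \<sigma> x" if "x \<in> \<rat>" for x
    using add[of x "- x"] that zero by simp
  have int: "\<sigma> (of_int k) = of_int k" for k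
    by (cases k rule: int_cases2) (auto simp: nat neg)
  obtain a b where ab: "r = of_int a / of_int b" "b \<noteq> 0"
    using assms(2) by (auto elim: Rats_cases')
  have "\<sigma> (r * of_int b) = \<sigma> r * \<sigma> (of_int b)" by (rule mult) (use assms(2) in auto)
  moreover have "r * of_int b = of_int a" using ab by simp
  ultimately have "of_int a = \<sigma> r * of_int b" by (simp only: int)
  with \<open>r * of_int b = of_int a\<close> have "\<sigma> r * of_int b = r * of_int b" by metis
  then show ?thesis using ab(2) by (metis mult_cancel_right of_int_eq_0_iff)
qed

lemma ex_nontrivial_automorphism:
  obtains \<tau> where "field_automorphism_on (rat_adjoin \<beta>) \<tau>" "\<exists>z\<in>rat_adjoin \<beta>. \<tau> z \<noteq> z"
    "\<And>r s. r \<in> \<rat> \<Longrightarrow> s \<in> \<rat> \<Longrightarrow> \<tau> (r + s * \<beta>) = r + s * (of_int t - \<beta>)"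
proof -
  let ?K = "rat_adjoin \<beta>"
  define \<tau> where "\<tau> x = (THE y. \<exists>r\<in>\<rat>. \<exists>s\<in>\<rat>. x = r + s * \<beta> \<and> y = r + s * (of_int t - \<beta>))" for x
  have \<tau>: "\<tau> (r + s * \<beta>) = r + s * (of_int t - \<beta>)" if "r \<in> \<rat>" "s \<in> \<rat>" for r s
    unfolding \<tau>_def by (rule the_equality) (use that coordinates_unique in blast)+
  have \<tau>': "\<tau> (r + s * (of_int t - \<beta>)) = r + s * \<beta>" if "r \<in> \<rat>" "s \<in> \<rat>" for r s
    using \<tau>[of "r + s * of_int t" "- s"] that by (simp add: algebra_simps)
  have closed: "\<tau> x \<in> ?K" if xK: "x \<in> ?K" for x
  proof -
    obtain r s where x: "r \<in> \<rat>" "s \<in> \<rat>" "x = r + s * \<beta>" using xK by (rule rat_adjoin_cases)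
    have "(r + s * of_int t) + (- s) * \<beta> \<in> ?K" using x by (intro rat_adjoinI) auto
    moreover have "\<tau> x = (r + s * of_int t) + (- s) * \<beta>"
      unfolding x(3) \<tau>[OF x(1,2)] by (simp add: algebra_simps)
    ultimately show ?thesis by simp
  qed
  have invol: "\<tau> (\<tau> x) = x" if "x \<in> ?K" for x
    using that \<tau> \<tau>' by (metis rat_adjoin_cases)
  have auto_\<tau>: "field_automorphism_on ?K \<tau>"
    unfolding field_automorphism_on_def
  proof (intro conjI ballI)
    show "bij_betw \<tau> ?K ?K" by (rule bij_betw_byWitness[where f' = \<tau>]) (use closed invol in auto)
    show "\<tau> 1 = 1" using \<tau>[of 1 0] by simp
    fix x y assume "x \<in> ?K" "y \<in> ?K"
    then obtain r s r' s' where x: "r \<in> \<rat>" "s \<in> \<rat>" "x = r + s * \<beta>"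
      and y: "r' \<in> \<rat>" "s' \<in> \<rat>" "y = r' + s' * \<beta>" by (metis rat_adjoin_cases)
    have "x + y = (r + r') + (s + s') * \<beta>" by (simp add: x y algebra_simps)
    then have "\<tau> (x + y) = (r + r') + (s + s') * (of_int t - \<beta>)"
      using \<tau>[of "r + r'" "s + s'"] x(1,2) y(1,2) by (simp only: Rats_add)
    then show "\<tau> (x + y) = \<tau> x + \<tau> y"
      unfolding x(3) y(3) \<tau>[OF x(1,2)] \<tau>[OF y(1,2)] by (simp add: algebra_simps)
    have "x * y = (r * r' - s * s' * of_int n) + (r * s' + s * r' + s * s' * of_int t) * \<beta>"
      using minimal_equation unfolding x y by algebra
    then have "\<tau> (x * y) = (r * r' - s * s' * of_int n)
                 + (r * s' + s * r' + s * s' * of_int t) * (of_int t - \<beta>)"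
      using x(1,2) y(1,2) by (simp add: \<tau>)
    also have "\<dots> = (r + s * (of_int t - \<beta>)) * (r' + s' * (of_int t - \<beta>))"
      using minimal_equation by algebra
    finally show "\<tau> (x * y) = \<tau> x * \<tau> y"
      unfolding x(3) y(3) \<tau>[OF x(1,2)] \<tau>[OF y(1,2)] .
  qed
  have nontrivial: "\<exists>z\<in>?K. \<tau> z \<noteq> z"
  proof
    show "\<beta> \<in> ?K" using rat_adjoinI[of 0 1] by simp
    have "\<tau> \<beta> = of_int t - \<beta>" using \<tau>[of 0 1] by simp
    moreover have "of_int t + (- 1) * \<beta> \<noteq> 0 + 1 * \<beta>"
      using coordinates_unique[of "of_int t" "- 1" 0 1] by auto
    ultimately show "\<tau> \<beta> \<noteq> \<beta>" by simp
  qed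
  show thesis by (rule that[OF auto_\<tau> nontrivial \<tau>])
qed

text \<open>Automorphisms fix the rationals, so the generator is mapped to a root of its minimal equation:
  to itself or to the other root. The first choice gives the identity.\<close>

lemma nontrivial_automorphism_coordinates:
  assumes \<sigma>: "field_automorphism_on (rat_adjoin \<beta>) \<sigma>" "z \<in> rat_adjoin \<beta>" "\<sigma> z \<noteq> z"
    and "r \<in> \<rat>" "s \<in> \<rat>"
  shows "\<sigma> (r + s * \<beta>) = r + s * (of_int t - \<beta>)"
proof -
  let ?K = "rat_adjoin \<beta>"
  have \<beta>K: "\<beta> \<in> ?K" using rat_adjoinI[of 0 1] by simp
  have lin: "\<sigma> (r + s * \<beta>) = r + s * \<sigma> \<beta>" if rs: "r \<in> \<rat>" "s \<in> \<rat>" for r s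
  proof -
    have K: "r \<in> ?K" "s \<in> ?K" "s * \<beta> \<in> ?K"
      using rat_adjoinI[of r 0] rat_adjoinI[of s 0] rat_adjoinI[of 0 s] rs by simp_all
    have "\<sigma> (r + s * \<beta>) = \<sigma> r + \<sigma> (s * \<beta>)"
      using K \<sigma>(1) by (simp add: field_automorphism_on_def)
    also have "\<sigma> (s * \<beta>) = \<sigma> s * \<sigma> \<beta>"
      using K \<beta>K \<sigma>(1) by (simp add: field_automorphism_on_def)
    finally show ?thesis using rs by (simp add: field_automorphism_Rats[OF \<sigma>(1)])
  qed
  have "\<sigma> (\<beta> * \<beta>) = \<sigma> (- of_int n + of_int t * \<beta>)" by (simp add: minimal_equation)
  then have "\<sigma> \<beta> * \<sigma> \<beta> = - of_int n + of_int t * \<sigma> \<beta>"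
    using lin[of "- of_int n" "of_int t"] \<beta>K \<sigma>(1) by (simp add: field_automorphism_on_def)
  then have "(\<sigma> \<beta> - \<beta>) * (\<sigma> \<beta> - (of_int t - \<beta>)) = 0"
    using minimal_equation by algebra
  moreover have "\<sigma> \<beta> \<noteq> \<beta>" using \<sigma>(2,3) lin by (metis rat_adjoin_cases)
  ultimately have "\<sigma> \<beta> = of_int t - \<beta>" by simp
  then show ?thesis using lin assms(4,5) by simp
qed

lemma quad_conj_coordinates:
  assumes "r \<in> \<rat>" "s \<in> \<rat>"
  shows "quad_conj \<beta> (r + s * \<beta>) = r + s * (of_int t - \<beta>)"
proof -
  let ?K = "rat_adjoin \<beta>"
  obtain \<tau> where \<tau>: "field_automorphism_on ?K \<tau>" "\<exists>z\<in>?K. \<tau> z \<noteq> z"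
    "\<tau> (r + s * \<beta>) = r + s * (of_int t - \<beta>)"
    using ex_nontrivial_automorphism assms by metis
  show ?thesis
    unfolding quad_conj_def
  proof (rule the_equality)
    show "\<exists>\<sigma>. field_automorphism_on ?K \<sigma> \<and> (\<exists>z\<in>?K. \<sigma> z \<noteq> z)
            \<and> r + s * (of_int t - \<beta>) = \<sigma> (r + s * \<beta>)"
      using \<tau> by (intro exI[of _ \<tau>]) simp
  next
    fix y
    assume "\<exists>\<sigma>. field_automorphism_on ?K \<sigma> \<and> (\<exists>z\<in>?K. \<sigma> z \<noteq> z) \<and> y = \<sigma> (r + s * \<beta>)"
    then show "y = r + s * (of_int t - \<beta>)"
      using nontrivial_automorphism_coordinates assms by auto
  qed
qed

lemma
  assumes "x \<in> rat_adjoin \<beta>" "y \<in> rat_adjoin \<beta>"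
  shows conj_add: "quad_conj \<beta> (x + y) = quad_conj \<beta> x + quad_conj \<beta> y"
    and conj_mult: "quad_conj \<beta> (x * y) = quad_conj \<beta> x * quad_conj \<beta> y"
proof -
  obtain \<tau> where \<tau>: "field_automorphism_on (rat_adjoin \<beta>) \<tau>"
    and coord: "\<And>r s. r \<in> \<rat> \<Longrightarrow> s \<in> \<rat> \<Longrightarrow> \<tau> (r + s * \<beta>) = r + s * (of_int t - \<beta>)"
    using ex_nontrivial_automorphism by metis
  have eq: "quad_conj \<beta> z = \<tau> z" if z: "z \<in> rat_adjoin \<beta>" for z
  proof -
    obtain r s where rs: "r \<in> \<rat>" "s \<in> \<rat>" "z = r + s * \<beta>" using z by (rule rat_adjoin_cases)
    show ?thesis unfolding rs(3) by (simp only: coord[OF rs(1,2)] quad_conj_coordinates[OF rs(1,2)])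
  qed
  have "x + y \<in> rat_adjoin \<beta>" "x * y \<in> rat_adjoin \<beta>"
    using assms by (auto intro: rat_adjoin_add rat_adjoin_mult)
  then show "quad_conj \<beta> (x + y) = quad_conj \<beta> x + quad_conj \<beta> y"
    "quad_conj \<beta> (x * y) = quad_conj \<beta> x * quad_conj \<beta> y"
    using \<tau> assms by (simp_all add: eq field_automorphism_on_def)
qed

lemma irrational_conj: "of_int t - \<beta> \<notin> \<rat>"
  using irrational by (metis Rats_diff Rats_of_int diff_diff_eq2 add_diff_cancel_left')

lemma conj_Rats [simp]: "r \<in> \<rat> \<Longrightarrow> quad_conj \<beta> r = r"
  using quad_conj_coordinates[of r 0] by simp

lemma conj_generator: "quad_conj \<beta> \<beta> = of_int t - \<beta>"
  using quad_conj_coordinates[of 0 1] by simp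

lemma rat_adjoin_Rats: "r \<in> \<rat> \<Longrightarrow> r \<in> rat_adjoin \<beta>"
  using rat_adjoinI[of r 0] by simp

lemma conj_diff:
  assumes "x \<in> rat_adjoin \<beta>" "y \<in> rat_adjoin \<beta>"
  shows "quad_conj \<beta> (x - y) = quad_conj \<beta> x - quad_conj \<beta> y"
  using conj_add[of "x - y" y] assms rat_adjoin_diff by simp

lemma conj_inverse:
  assumes "x \<in> rat_adjoin \<beta>"
  shows "quad_conj \<beta> (inverse x) = inverse (quad_conj \<beta> x)"
proof (cases "x = 0")
  case False
  then have "quad_conj \<beta> x * quad_conj \<beta> (inverse x) = 1"
    using conj_mult[of x "inverse x"] assms rat_adjoin_inverse by simp
  then show ?thesis by (simp add: inverse_unique)
qed simp

lemma norm_Rats: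
  assumes "x \<in> rat_adjoin \<beta>"
  shows "x * quad_conj \<beta> x \<in> \<rat>"
proof -
  obtain r s where x: "r \<in> \<rat>" "s \<in> \<rat>" "x = r + s * \<beta>" using assms by (rule rat_adjoin_cases)
  then have "x * quad_conj \<beta> x = r * r + r * s * of_int t + s * s * of_int n"
    using quad_conj_coordinates[OF x(1,2)] norm_coordinates by simp
  then show ?thesis using x by simp
qed

text \<open>The ring \<open>\<int>[\<beta>]\<close>. It contains all \<open>\<beta>\<close>-integers, and traces and norms of its elements are
  integers.\<close>

definition quad_order :: "real set" where
  "quad_order = {of_int i + of_int j * \<beta> | i j. True}"

lemma quad_orderI: "of_int i + of_int j * \<beta> \<in> quad_order"
  by (auto simp: quad_order_def)

lemma quad_order_Ints: "of_int i \<in> quad_order" and quad_order_0: "0 \<in> quad_order"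
  and quad_order_1: "1 \<in> quad_order"
  and quad_order_generator: "\<beta> \<in> quad_order"
  using quad_orderI[of i 0] quad_orderI[of 0 0] quad_orderI[of 1 0] quad_orderI[of 0 1] by simp_all

lemma quad_order_add:
  assumes "x \<in> quad_order" "y \<in> quad_order"
  shows "x + y \<in> quad_order"
proof -
  obtain i j k l where "x = of_int i + of_int j * \<beta>" "y = of_int k + of_int l * \<beta>"
    using assms by (auto simp: quad_order_def)
  then have "x + y = of_int (i + k) + of_int (j + l) * \<beta>" by (simp add: algebra_simps)
  then show ?thesis by (simp only: quad_orderI)
qed

lemma quad_order_mult:
  assumes "x \<in> quad_order" "y \<in> quad_order"
  shows "x * y \<in> quad_order"
proof -
  obtain i j k l where xy: "x = of_int i + of_int j * \<beta>" "y = of_int k + of_int l * \<beta>"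
    using assms by (auto simp: quad_order_def)
  have "x * y = of_int (i * k - j * l * n) + of_int (i * l + j * k + j * l * t) * \<beta>"
    using minimal_equation unfolding xy of_int_add of_int_mult of_int_diff by algebra
  then show ?thesis by (simp only: quad_orderI)
qed

lemma quad_order_subset: "x \<in> quad_order \<Longrightarrow> x \<in> rat_adjoin \<beta>"
  by (auto simp: quad_order_def)

lemma quad_order_trace_norm:
  assumes "x \<in> quad_order"
  shows "x + quad_conj \<beta> x \<in> \<int>" "x * quad_conj \<beta> x \<in> \<int>"
proof -
  obtain i j where x: "x = of_int i + of_int j * \<beta>" using assms by (auto simp: quad_order_def)
  have c: "quad_conj \<beta> x = of_int i + of_int j * (of_int t - \<beta>)"
    unfolding x by (rule quad_conj_coordinates) auto
  have "x + quad_conj \<beta> x = of_int (2 * i + j * t)"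
    unfolding c unfolding x by (simp add: algebra_simps)
  then show "x + quad_conj \<beta> x \<in> \<int>" by (simp only: Ints_of_int)
  have "x * quad_conj \<beta> x = of_int (i * i + i * j * t + j * j * n)"
    unfolding c unfolding x of_int_add of_int_mult by (rule norm_coordinates)
  then show "x * quad_conj \<beta> x \<in> \<int>" by (simp only: Ints_of_int)
qed

text \<open>The number \<open>e\<close> is a unit of the ring of integers, since \<open>e\<close> and \<open>1/e\<close> are integral over
  \<open>\<int>[\<beta>]\<close>. To see directly that its norm \<open>N\<close> is \<open>\<plusminus>1\<close>, conjugate the equation to get
  \<open>T = e + d/e\<close> and \<open>T' = e' + d/e'\<close>. Eliminating \<open>e\<close> and \<open>e'\<close> shows that the rational number
  \<open>m = N + 1/N\<close> satisfies a monic quadratic equation whose coefficients are integer polynomials in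
  \<open>T + T'\<close> and \<open>T T'\<close>. So \<open>m\<close> is an integer; then \<open>N\<^sup>2 - m N + 1 = 0\<close> makes \<open>N\<close> an integer
  that divides \<open>1\<close>.\<close>

lemma norm_of_unit:
  assumes "e \<in> rat_adjoin \<beta>" "T \<in> quad_order" "d * d = 1" "d \<in> \<int>" "e * e - T * e + d = 0"
  shows "e * quad_conj \<beta> e = 1 \<or> e * quad_conj \<beta> e = - 1"
proof -
  let ?e = "quad_conj \<beta> e" and ?T = "quad_conj \<beta> T"
  have T: "T \<in> rat_adjoin \<beta>" using assms(2) by (rule quad_order_subset)
  have d: "d \<in> \<rat>" "d \<in> rat_adjoin \<beta>" using assms(4) rat_adjoin_Rats Ints_subset_Rats by blast+
  have "quad_conj \<beta> (e * e - T * e + d) = ?e * ?e - ?T * ?e + d"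
    using assms(1) T d by (simp add: conj_add conj_diff conj_mult rat_adjoin_mult rat_adjoin_diff)
  then have conj_eq: "?e * ?e - ?T * ?e + d = 0" using assms(5) by simp
  define N where "N = e * ?e"
  have NQ: "N \<in> \<rat>" unfolding N_def using assms(1) by (rule norm_Rats)
  have e0: "e \<noteq> 0" "?e \<noteq> 0" using assms(3,5) conj_eq by auto
  then have N0: "N \<noteq> 0" by (simp add: N_def)
  define m where "m = N + 1 / N"
  define S where "S = T + ?T" define W where "W = T * ?T"
  have SW: "S \<in> \<int>" "W \<in> \<int>" using quad_order_trace_norm[OF assms(2)] by (auto simp: S_def W_def)
  have TT: "T = e + d / e" "?T = ?e + d / ?e" using assms(5) conj_eq e0 by (auto simp: field_simps)
  have "m * m + (- W) * m + d * (S * S - 2 * W - 4 * d) = 0"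
  proof -
    define f g where "f = 1 / e" and "g = 1 / ?e"
    have fg: "e * f = 1" "?e * g = 1" using e0 by (auto simp: f_def g_def)
    have m: "m = e * ?e + f * g" by (simp add: m_def N_def f_def g_def)
    have T': "T = e + d * f" "?T = ?e + d * g" using TT by (auto simp: f_def g_def)
    define q where "q = e * g + f * ?e"
    have "W = m + d * q"
      unfolding W_def m q_def T'(2) using T'(1) assms(3) by algebra
    moreover have "S * S - 2 * W - 4 * d = q * m"
    proof -
      have "S * S - 2 * W = T * T + ?T * ?T" by (simp add: S_def W_def algebra_simps)
      moreover have "T * T = e * e + f * f + 2 * d"
        using T'(1) fg(1) assms(3) by algebra
      moreover have "?T * ?T = ?e * ?e + g * g + 2 * d"
        unfolding T'(2) using fg(2) assms(3) by algebra
      moreover have "q * m = e * e + f * f + (?e * ?e + g * g)"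
        unfolding q_def m using fg by algebra
      ultimately show ?thesis by simp
    qed
    ultimately show ?thesis by (simp add: algebra_simps)
  qed
  moreover have "d * (S * S - 2 * W - 4 * d) \<in> \<int>" "- W \<in> \<int>" using SW assms(4) by auto
  moreover have "m \<in> \<rat>" using NQ by (simp add: m_def)
  ultimately have "m \<in> \<int>" by (metis Ints_root_monic_quadratic)
  have eqN: "N * N + (- m) * N + 1 = 0" using N0 by (simp add: m_def field_simps)
  then have "N \<in> \<int>" using NQ \<open>m \<in> \<int>\<close>
    by (intro Ints_root_monic_quadratic[of N "- m" 1, OF _ _ _ eqN]) auto
  then obtain k l where kl: "N = of_int k" "m = of_int l" using \<open>m \<in> \<int>\<close> by (auto elim!: Ints_cases)
  have "N * (m - N) = 1" using eqN by (simp add: algebra_simps)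
  then have "of_int (k * (l - k)) = (1 :: real)" by (simp add: kl)
  then have "k * (l - k) = 1" by linarith
  then have "k = 1 \<or> k = - 1" using zmult_eq_1_iff by blast
  then show ?thesis using kl by (auto simp: N_def)
qed

end

section \<open>Continued fractions with real partial quotients\<close>

text \<open>The general solution of the recurrence of numerators and denominators of convergents, with
  arbitrary initial values. The solutions with \<open>(u, v) = (1, 0)\<close> and \<open>(u, v) = (0, 1)\<close>, taken at
  \<open>Suc k\<close> and \<open>k\<close>, form the two rows of the product of the matrices with rows \<open>(c i, 1)\<close> and
  \<open>(1, 0)\<close> for \<open>i < k\<close>.\<close>

fun continuant :: "(nat \<Rightarrow> real) \<Rightarrow> real \<Rightarrow> real \<Rightarrow> nat \<Rightarrow> real" where
  "continuant c u v 0 = v"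
| "continuant c u v (Suc 0) = u"
| "continuant c u v (Suc (Suc k)) = c k * continuant c u v (Suc k) + continuant c u v k"

text \<open>The Moebius transformation that gives \<open>x 0\<close> in terms of \<open>x k\<close>, with its denominator cleared.
  If \<open>x k = x 0\<close>, it says that \<open>(x 0, 1)\<close> is an eigenvector of the matrix of continuants.\<close>

lemma continuant_complete_quotient:
  assumes "\<And>i. x i \<noteq> 0" "\<And>i. x i = c i + 1 / x (Suc i)"
  shows "x 0 * (continuant c 0 1 (Suc k) * x k + continuant c 0 1 k)
         = continuant c 1 0 (Suc k) * x k + continuant c 1 0 k"
proof (induction k)
  case (Suc k)
  have step: "continuant c u v (Suc (Suc k)) * x (Suc k) + continuant c u v (Suc k)
        = x (Suc k) * (continuant c u v (Suc k) * x k + continuant c u v k)" for u v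
  proof -
    have "x k * x (Suc k) = c k * x (Suc k) + 1"
      using assms(1)[of "Suc k"] assms(2)[of k] by (simp add: field_simps)
    then show ?thesis unfolding continuant.simps by algebra
  qed
  show ?case using Suc.IH unfolding step by algebra
qed simp

lemma continuant_determinant:
  "continuant c 1 0 (Suc k) * continuant c 0 1 k - continuant c 1 0 k * continuant c 0 1 (Suc k)
   = (- 1) ^ k"
proof (induction k)
  case (Suc k)
  then show ?case by (simp add: algebra_simps)
qed simp

lemma continuant_nonneg:
  assumes "u \<ge> 0" "v \<ge> 0" "\<And>i. c i \<ge> 0"
  shows "continuant c u v k \<ge> 0"
  using assms by (induction c u v k rule: continuant.induct) auto

lemma continuant_mono:
  assumes "u \<ge> 0" "v \<ge> 0" "\<And>i. 0 \<le> c i" "\<And>i. c i \<le> c' i"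
  shows "continuant c u v k \<le> continuant c' u v k"
  using assms
proof (induction c u v k rule: continuant.induct)
  case (3 c u v k)
  have "c k * continuant c u v (Suc k) \<le> c' k * continuant c' u v (Suc k)"
    using 3 by (intro mult_mono continuant_nonneg) (auto intro: order_trans)
  then show ?case using 3 by (auto intro: add_mono)
qed auto

lemma continuant_ge_1:
  assumes "\<And>i. 1 \<le> c i"
  shows "continuant c 1 0 (Suc k) \<ge> 1"
proof (induction k)
  case (Suc k)
  have c0: "\<And>i. 0 \<le> c i" using assms by (auto intro: order_trans[of 0 1])
  have "1 * 1 \<le> c k * continuant c 1 0 (Suc k)"
    using assms[of k] Suc by (intro mult_mono) auto
  then show ?case using continuant_nonneg[of 1 0 c k] c0 by simp
qed simp

text \<open>The numerator depends strictly increasingly on each partial quotient. In the recurrence, equality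
  of the sums forces equality of all terms, and the factors are positive.\<close>

lemma continuant_strict_mono:
  assumes "\<And>i. 1 \<le> c i" "\<And>i. c i \<le> c' i"
    and "continuant c 1 0 (Suc k) = continuant c' 1 0 (Suc k)" "i < k"
  shows "c i = c' i"
  using assms(3,4)
proof (induction k arbitrary: i)
  case (Suc k)
  have c0: "0 \<le> c i" and c'1: "1 \<le> c' i" for i
    using assms(1)[of i] assms(2)[of i] by auto
  let ?A = "continuant c 1 0" and ?A' = "continuant c' 1 0"
  have A1: "?A (Suc k) \<ge> 1" using assms(1) by (rule continuant_ge_1)
  have le: "?A j \<le> ?A' j" for j using c0 assms(2) by (intro continuant_mono) auto
  have 1: "c k * ?A (Suc k) \<le> c' k * ?A (Suc k)" using assms(2)[of k] A1 by (intro mult_right_mono) auto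
  have 2: "c' k * ?A (Suc k) \<le> c' k * ?A' (Suc k)" using c'1[of k] le by (intro mult_left_mono) auto
  have eq: "c k * ?A (Suc k) + ?A k = c' k * ?A' (Suc k) + ?A' k" using Suc.prems(1) by simp
  have "c k * ?A (Suc k) = c' k * ?A (Suc k)" using 1 2 eq le[of k] by linarith
  then have ck: "c k = c' k" using A1 by auto
  have "c' k * ?A (Suc k) = c' k * ?A' (Suc k)" using 1 2 eq le[of k] by linarith
  then have "?A (Suc k) = ?A' (Suc k)" using c'1[of k] by auto
  then show ?case using ck Suc.IH Suc.prems(2) by (auto simp: less_Suc_eq)
qed simp

text \<open>Two such sequences stay less than \<open>1\<close> apart. On the other hand, passing from \<open>i\<close> to \<open>Suc i\<close>
  multiplies their distance by \<open>x (Suc i) * y (Suc i)\<close>, and the product of two consecutive complete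
  quotients is at least \<open>2\<close>. So a non-zero distance would grow at least by the factor \<open>4\<close> every
  two steps.\<close>

lemma complete_quotient_unique:
  fixes x y c :: "nat \<Rightarrow> real"
  assumes x: "\<And>i. 1 < x i" "\<And>i. x i = c i + 1 / x (Suc i)"
    and y: "\<And>i. 1 < y i" "\<And>i. y i = c i + 1 / y (Suc i)"
    and c: "\<And>i. 1 \<le> c i"
  shows "x 0 = y 0"
proof (rule ccontr)
  assume "x 0 \<noteq> y 0"
  have bound: "\<bar>x i - y i\<bar> < 1" for i
  proof -
    have "0 < 1 / x (Suc i)" "1 / x (Suc i) < 1" "0 < 1 / y (Suc i)" "1 / y (Suc i) < 1"
      using x(1)[of "Suc i"] y(1)[of "Suc i"] by auto
    then show ?thesis using x(2)[of i] y(2)[of i] by linarith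
  qed
  have step: "\<bar>x (Suc i) - y (Suc i)\<bar> = x (Suc i) * y (Suc i) * \<bar>x i - y i\<bar>" for i
  proof -
    have pos: "0 < x (Suc i)" "0 < y (Suc i)" using x(1)[of "Suc i"] y(1)[of "Suc i"] by auto
    have "x (Suc i) * y (Suc i) * (x i - y i) = y (Suc i) - x (Suc i)"
    proof -
      have "x i * x (Suc i) = c i * x (Suc i) + 1" "y i * y (Suc i) = c i * y (Suc i) + 1"
        using x(2)[of i] y(2)[of i] pos by (simp_all add: field_simps)
      then show ?thesis by algebra
    qed
    then have "\<bar>x (Suc i) - y (Suc i)\<bar> = \<bar>x (Suc i) * y (Suc i) * (x i - y i)\<bar>" by simp
    then show ?thesis using pos by (simp add: abs_mult)
  qed
  have two: "2 \<le> z i * z (Suc i)" if "\<And>i. 1 < z i" "\<And>i. z i = c i + 1 / z (Suc i)" for z i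
  proof -
    have "z i * z (Suc i) = c i * z (Suc i) + 1"
      using that(1)[of "Suc i"] that(2)[of i] by (simp add: field_simps)
    moreover have "1 * 1 \<le> c i * z (Suc i)"
      using c[of i] that(1)[of "Suc i"] by (intro mult_mono) auto
    ultimately show ?thesis by simp
  qed
  have grow: "4 ^ k * \<bar>x 0 - y 0\<bar> \<le> \<bar>x (2 * k) - y (2 * k)\<bar>" for k
  proof (induction k)
    case (Suc k)
    let ?i = "2 * k"
    have "2 * 2 \<le> (x (Suc ?i) * x (Suc (Suc ?i))) * (y (Suc ?i) * y (Suc (Suc ?i)))"
      by (rule mult_mono) (use two[OF x] two[OF y] in \<open>auto intro: order_trans[of 0 2]\<close>)
    then have "4 * \<bar>x ?i - y ?i\<bar>
        \<le> (x (Suc ?i) * x (Suc (Suc ?i))) * (y (Suc ?i) * y (Suc (Suc ?i))) * \<bar>x ?i - y ?i\<bar>"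
      by (intro mult_right_mono) auto
    also have "\<dots> = \<bar>x (Suc (Suc ?i)) - y (Suc (Suc ?i))\<bar>"
      unfolding step by (simp add: mult_ac)
    finally show ?case using Suc.IH by simp
  qed simp
  obtain k :: nat where "1 / \<bar>x 0 - y 0\<bar> < 4 ^ k"
    using real_arch_pow[of 4] by auto
  then have "1 < 4 ^ k * \<bar>x 0 - y 0\<bar>" using \<open>x 0 \<noteq> y 0\<close> by (simp add: field_simps)
  then show False using grow[of k] bound[of "2 * k"] by simp
qed

section \<open>Periodic continued fractions over a quadratic field\<close>

context real_quadratic
begin

lemma quad_order_continuant:
  assumes "\<And>i. c i \<in> quad_order" "u \<in> quad_order" "v \<in> quad_order"
  shows "continuant c u v k \<in> quad_order"
  using assms by (induction c u v k rule: continuant.induct) (auto intro: quad_order_add quad_order_mult)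

lemma conj_continuant:
  assumes "\<And>i. c i \<in> quad_order" "u \<in> quad_order" "v \<in> quad_order"
  shows "quad_conj \<beta> (continuant c u v k)
         = continuant (\<lambda>i. quad_conj \<beta> (c i)) (quad_conj \<beta> u) (quad_conj \<beta> v) k"
  using assms
proof (induction c u v k rule: continuant.induct)
  case (3 c u v k)
  then show ?case
    using quad_order_continuant[of c u v] quad_order_subset
    by (simp add: conj_add conj_mult rat_adjoin_mult)
qed auto

text \<open>The matrix of continuants over one period has the eigenvector \<open>(x 0, 1)\<close> with eigenvalue \<open>e\<close>, a
  unit of norm \<open>\<plusminus>1\<close>. This forces its trace \<open>A + D\<close> to agree with its conjugate \<open>A' + D'\<close> up to sign.
  Since the entries are monotone in the partial quotients, \<open>A = A'\<close>, and strict monotonicity gives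
  the claim.\<close>

lemma conj_fixes_periodic_partial_quotients:
  assumes x: "\<And>i. x i \<in> rat_adjoin \<beta>" "\<And>i. x i \<noteq> 0" "\<And>i. x i = c i + 1 / x (Suc i)"
    and c: "\<And>i. c i \<in> quad_order" "\<And>i. 1 \<le> c i" "\<And>i. c i \<le> quad_conj \<beta> (c i)"
    and period: "x p = x 0" and "i < p"
  shows "quad_conj \<beta> (c i) = c i"
proof -
  let ?c = "\<lambda>i. quad_conj \<beta> (c i)"
  define A B C D where ABCD: "A = continuant c 1 0 (Suc p)" "B = continuant c 1 0 p"
    "C = continuant c 0 1 (Suc p)" "D = continuant c 0 1 p"
  define A' D' where A'D': "A' = continuant ?c 1 0 (Suc p)" "D' = continuant ?c 0 1 p"
  have ord: "A \<in> quad_order" "C \<in> quad_order" "D \<in> quad_order"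
    unfolding ABCD using c(1) quad_order_0 quad_order_1
    by (auto intro: quad_order_continuant simp del: continuant.simps)
  have conjA: "quad_conj \<beta> A = A'" "quad_conj \<beta> D = D'"
    unfolding ABCD A'D' by (subst conj_continuant; use c(1) quad_order_0 quad_order_1 in simp)+
  have c0: "0 \<le> c i" for i using c(2)[of i] by simp
  have le: "A \<le> A'" "D \<le> D'"
    unfolding ABCD A'D' using c0 c(3) by (auto intro!: continuant_mono simp del: continuant.simps)
  have A1: "A \<ge> 1" unfolding ABCD using c(2) by (rule continuant_ge_1)
  have D0: "D \<ge> 0" unfolding ABCD using c0 by (auto intro: continuant_nonneg)
  define d :: real where "d = (- 1) ^ p"
  have d: "d * d = 1" "d \<in> \<int>" by (auto simp: d_def simp flip: power_mult_distrib)
  define e where "e = C * x 0 + D"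
  have eig: "x 0 * e = A * x 0 + B"
    using continuant_complete_quotient[of x c p, OF x(2) x(3)] period 
    by (simp add: e_def ABCD del: continuant.simps)
  have det: "A * D - B * C = d" using continuant_determinant[of c p] by (simp add: ABCD d_def)
  have char: "e * e - (A + D) * e + d = 0" using eig det e_def by algebra
  have eK: "e \<in> rat_adjoin \<beta>" unfolding e_def
    using ord x(1) quad_order_subset by (intro rat_adjoin_add rat_adjoin_mult) auto
  let ?e = "quad_conj \<beta> e"
  have dK: "d \<in> \<rat>" using d Ints_subset_Rats by blast
  have TK: "A + D \<in> quad_order" using ord by (intro quad_order_add) auto
  have "quad_conj \<beta> (e * e - (A + D) * e + d) = ?e * ?e - (A' + D') * ?e + d"
    using eK quad_order_subset[OF TK] quad_order_subset[OF ord(1)] quad_order_subset[OF ord(3)] dK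
    by (simp add: conj_add conj_diff conj_mult rat_adjoin_mult rat_adjoin_diff rat_adjoin_Rats conjA)
  then have char': "?e * ?e - (A' + D') * ?e + d = 0" using char by simp
  have e0: "e \<noteq> 0" "?e \<noteq> 0" using d char char' by auto
  have "e * ?e = 1 \<or> e * ?e = - 1" using norm_of_unit[OF eK TK d char] .
  then obtain s where s: "e * ?e = s" "s * s = 1" by auto
  \<comment> \<open>With \<open>e e' = s\<close> the conjugate trace \<open>e' + d / e'\<close> is \<open>s d (d / e + e)\<close>.\<close>
  have "(A' + D') * (A' + D') = (A + D) * (A + D)"
  proof -
    have "e * (A' + D') = s * d * e * (A + D)"
    proof -
      have "?e * (e * (A' + D') - s * d * e * (A + D)) = 0"
      proof -
        have "?e * (e * (A' + D')) = e * (?e * ?e + d)" using char' by (simp add: algebra_simps)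
        also have "\<dots> = s * ?e + d * e" by (simp add: s(1)[symmetric] algebra_simps)
        finally have 1: "?e * (e * (A' + D')) = s * ?e + d * e" .
        have "?e * (s * d * e * (A + D)) = s * d * ?e * (e * e + d)"
          using char by (simp add: algebra_simps)
        also have "\<dots> = d * (s * (e * ?e)) * e + s * (d * d) * ?e" by (simp add: algebra_simps)
        also have "\<dots> = d * e + s * ?e" by (simp add: s d(1))
        finally show ?thesis using 1 by (simp add: algebra_simps)
      qed
      then show ?thesis using e0 by simp
    qed
    then have "A' + D' = s * d * (A + D)" using e0 by simp
    then show ?thesis using s d by algebra
  qed
  then have "A' + D' = A + D \<or> A' + D' = - (A + D)" by (simp only: square_eq_iff)
  then have "A' + D' = A + D" using le A1 D0 by linarith
  then have "A = A'" using le by simp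
  then show ?thesis
    using continuant_strict_mono[of c ?c p i] c \<open>i < p\<close> unfolding ABCD A'D' by simp
qed

end

section \<open>Integer parts with respect to a real base\<close>

text \<open>Finite digit words with the greedy condition give \<open>\<beta>\<close>-integers: the digits are placed at the
  non-negative positions and all infinite sums of the definition reduce to finite ones.\<close>

lemma greedy_word_beta_integer:
  assumes "b > 1" and digits: "\<And>i. 0 \<le> e i \<and> of_int (e i) < b"
    and greedy: "\<And>j. j < k \<Longrightarrow> (\<Sum>i\<le>j. of_int (e i) * b ^ i) < b ^ Suc j"
  shows "(\<Sum>i<k. of_int (e i) * b ^ i) \<in> beta_integers b"
proof -
  let ?y = "\<Sum>i<k. of_int (e i) * b ^ i"
  define d where "d i = (if 0 \<le> i \<and> i < int k then e (nat i) else 0)" for i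
  define f where "f i = of_int (d i) * b powi i" for i
  have y0: "?y \<ge> 0" using assms by (intro sum_nonneg) auto
  have sum: "(f has_sum (\<Sum>i | i < k \<and> int i \<le> j. of_int (e i) * b ^ i)) {..j}" for j
  proof -
    let ?I = "{i. i < k \<and> int i \<le> j}"
    have "(f has_sum sum f (int ` ?I)) (int ` ?I)" by (rule has_sum_finite) simp
    moreover have "sum f (int ` ?I) = (\<Sum>i | i < k \<and> int i \<le> j. of_int (e i) * b ^ i)"
      by (subst sum.reindex) (auto simp: f_def d_def intro!: sum.cong)
    moreover have "(f has_sum s) (int ` ?I) \<longleftrightarrow> (f has_sum s) {..j}" for s
    proof (rule has_sum_cong_neutral)
      fix i assume "i \<in> {..j} - int ` ?I"
      then have "\<not> (0 \<le> i \<and> i < int k)" by (auto simp: image_iff) (metis nat_0_le nat_less_iff)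
      then show "f i = 0" by (auto simp: f_def d_def)
    qed auto
    ultimately show ?thesis by simp
  qed
  have "greedy_expansion b ?y d"
    unfolding greedy_expansion_def
  proof (intro conjI exI[of _ "int k - 1"] allI impI)
    fix i show "0 \<le> d i" "of_int (d i) < b" using assms by (auto simp: d_def)
  next
    fix i :: int assume "int k - 1 < i" then show "d i = 0" by (simp add: d_def)
  next
    have "{i. i < k \<and> int i \<le> int k - 1} = {..<k}" by auto
    then show "((\<lambda>i. of_int (d i) * b powi i) has_sum ?y) {..int k - 1}"
      using sum[of "int k - 1"] by (simp add: f_def[abs_def])
  next
    fix j assume j: "j \<le> int k - 1"
    have inf: "(\<Sum>\<^sub>\<infinity>i\<in>{..j}. of_int (d i) * b powi i) = (\<Sum>i | i < k \<and> int i \<le> j. of_int (e i) * b ^ i)"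
      using sum[of j] by (simp add: f_def[abs_def] infsumI)
    show "(\<Sum>\<^sub>\<infinity>i\<in>{..j}. of_int (d i) * b powi i) < b powi (j + 1)"
    proof (cases "j < 0")
      case True
      then have empty: "{i. i < k \<and> int i \<le> j} = {}" by auto
      show ?thesis unfolding inf empty using \<open>b > 1\<close> by simp
    next
      case False
      then obtain m where m: "j = int m" by (metis nonneg_int_cases not_less)
      have "{i. i < k \<and> int i \<le> j} = {..m}" using j m by auto
      moreover have "b powi (j + 1) = b ^ Suc m" unfolding m
        by (metis of_nat_Suc power_int_of_nat add.commute)
      ultimately show ?thesis unfolding inf using greedy[of m] j m by simp
    qed
  qed
  moreover have "\<forall>i<0. d i = 0" by (simp add: d_def)
  ultimately show ?thesis using y0 by (auto simp: beta_integers_def)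
qed

lemma beta_integer_digits:
  assumes "y \<in> beta_integers b" "y \<ge> 0"
  obtains k e where "\<And>i. 0 \<le> e i" "\<And>i. of_int (e i) < b" "y = (\<Sum>i<k. of_int (e i) * b ^ i)"
proof -
  obtain d K where d: "\<And>i. 0 \<le> d i" "\<And>i. of_int (d i) < b" "\<And>i. i < 0 \<Longrightarrow> d i = 0"
    and s: "((\<lambda>i. of_int (d i) * b powi i) has_sum y) {..K}"
    using assms by (auto simp: beta_integers_def greedy_expansion_def)
  define k where "k = nat (K + 1)"
  let ?f = "\<lambda>i. of_int (d i) * b powi i"
  have "(?f has_sum y) (int ` {..<k}) \<longleftrightarrow> (?f has_sum y) {..K}"
  proof (rule has_sum_cong_neutral)
    fix i assume "i \<in> {..K} - int ` {..<k}"
    moreover have "i \<in> int ` {..<k}" if "0 \<le> i" "i \<le> K"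
      by (rule image_eqI[of _ _ "nat i"]) (use that in \<open>auto simp: k_def\<close>)
    ultimately have "i < 0" by force
    then show "?f i = 0" using d by simp
  qed (auto simp: k_def)
  then have "(?f has_sum y) (int ` {..<k})" using s by simp
  moreover have "(?f has_sum (\<Sum>i\<in>int ` {..<k}. ?f i)) (int ` {..<k})"
    by (rule has_sum_finite) simp
  ultimately have "y = (\<Sum>i\<in>int ` {..<k}. ?f i)" by (rule has_sum_unique)
  also have "\<dots> = (\<Sum>i<k. of_int (d (int i)) * b ^ i)"
    by (subst sum.reindex) auto
  finally show ?thesis using d that[of "\<lambda>i. d (int i)" k] by simp
qed

lemma beta_integer_1:
  assumes "b > 1"
  shows "1 \<in> beta_integers b"
  using greedy_word_beta_integer[of b "\<lambda>i. if i = 0 then 1 else 0" 1] assms by simp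

lemma beta_integer_base:
  assumes "b > 1"
  shows "b \<in> beta_integers b"
proof -
  let ?e = "\<lambda>i::nat. if i = 1 then 1 else 0 :: int"
  have "(\<Sum>i<2. of_int (?e i) * b ^ i) \<in> beta_integers b"
  proof (rule greedy_word_beta_integer)
    fix j :: nat assume "j < 2"
    then have "j = 0 \<or> j = 1" by auto
    then show "(\<Sum>i\<le>j. of_int (?e i) * b ^ i) < b ^ Suc j" using assms by auto
  qed (use assms in auto)
  then show ?thesis by (simp add: numeral_2_eq_2)
qed

text \<open>The greedy algorithm, run from position \<open>k - 1\<close> down to \<open>0\<close>: at each position the digit is the
  integer part of the quotient by the power of \<open>b\<close>, and what remains at the end is less than \<open>1\<close>.\<close>

lemma greedy_integer_part:
  fixes b x :: real
  assumes "b > 1" "0 \<le> x" "x < b ^ k"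
  shows "\<exists>e. (\<forall>i. 0 \<le> e i \<and> of_int (e i) < b)
           \<and> (\<forall>j<k. (\<Sum>i\<le>j. of_int (e i) * b ^ i) < b ^ Suc j)
           \<and> (\<Sum>i<k. of_int (e i) * b ^ i) \<le> x \<and> x < (\<Sum>i<k. of_int (e i) * b ^ i) + 1"
  using assms(2,3)
proof (induction k arbitrary: x)
  case 0
  then show ?case using \<open>b > 1\<close> by (intro exI[of _ "\<lambda>_. 0"]) auto
next
  case (Suc k)
  have bk: "b ^ k > 0" using \<open>b > 1\<close> by simp
  define q where "q = \<lfloor>x / b ^ k\<rfloor>"
  have q0: "0 \<le> q" using Suc.prems bk by (simp add: q_def)
  have qx: "of_int q * b ^ k \<le> x" using bk by (simp add: q_def flip: pos_le_divide_eq)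
  have "x / b ^ k < of_int q + 1" unfolding q_def by linarith
  then have xq: "x < (of_int q + 1) * b ^ k" using bk by (simp add: pos_divide_less_eq)
  have "of_int q * b ^ k < b * b ^ k" using qx Suc.prems by simp
  then have qb: "of_int q < b" using bk by simp
  define r where "r = x - of_int q * b ^ k"
  have "0 \<le> r" "r < b ^ k" using qx xq by (auto simp: r_def algebra_simps)
  from Suc.IH[OF this] obtain e where e: "\<forall>i. 0 \<le> e i \<and> of_int (e i) < b"
    "\<forall>j<k. (\<Sum>i\<le>j. of_int (e i) * b ^ i) < b ^ Suc j"
    "(\<Sum>i<k. of_int (e i) * b ^ i) \<le> r" "r < (\<Sum>i<k. of_int (e i) * b ^ i) + 1"
    by blast
  define e' where "e' = e(k := q)"
  have low: "(\<Sum>i\<in>I. of_int (e' i) * b ^ i) = (\<Sum>i\<in>I. of_int (e i) * b ^ i)"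
    if "I \<subseteq> {..<k}" for I
    using that by (intro sum.cong) (auto simp: e'_def)
  have total: "(\<Sum>i<Suc k. of_int (e' i) * b ^ i) = (\<Sum>i<k. of_int (e i) * b ^ i) + of_int q * b ^ k"
    using low[of "{..<k}"] by (simp add: e'_def)
  show ?case
  proof (intro exI[of _ e'] conjI allI impI)
    fix i show "0 \<le> e' i" "of_int (e' i) < b" using e q0 qb by (auto simp: e'_def)
  next
    fix j assume "j < Suc k"
    show "(\<Sum>i\<le>j. of_int (e' i) * b ^ i) < b ^ Suc j"
    proof (cases "j = k")
      case True
      then show ?thesis using total e(3) Suc.prems by (simp add: r_def lessThan_Suc_atMost)
    next
      case False
      then have "j < k" using \<open>j < Suc k\<close> by simp
      moreover have "{..j} \<subseteq> {..<k}" using \<open>j < k\<close> by auto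
      ultimately show ?thesis using e(2) low[of "{..j}"] by simp
    qed
  qed (use total e in \<open>auto simp: r_def\<close>)
qed

lemma beta_integer_within_1:
  assumes "b > 1" "0 \<le> x"
  obtains y where "y \<in> beta_integers b" "0 \<le> y" "y \<le> x" "x < y + 1"
proof -
  obtain k where "x < b ^ k" using assms(1) real_arch_pow by blast
  from greedy_integer_part[OF assms this] obtain e
    where e: "\<forall>i. 0 \<le> e i \<and> of_int (e i) < b"
    "\<forall>j<k. (\<Sum>i\<le>j. of_int (e i) * b ^ i) < b ^ Suc j"
    "(\<Sum>i<k. of_int (e i) * b ^ i) \<le> x" "x < (\<Sum>i<k. of_int (e i) * b ^ i) + 1"
    by blast
  have "(\<Sum>i<k. of_int (e i) * b ^ i) \<in> beta_integers b"
    using assms(1) e by (intro greedy_word_beta_integer) auto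
  moreover have "0 \<le> (\<Sum>i<k. of_int (e i) * b ^ i)"
    using assms(1) e by (intro sum_nonneg) auto
  ultimately show ?thesis using that e by blast
qed

text \<open>A \<open>\<beta>\<close>-integer up to \<open>x < b ^ N\<close> has no digit at a position from \<open>N\<close> on, and there are finitely
  many words of length \<open>N\<close>.\<close>

lemma finite_beta_integers_below:
  assumes "b > 1"
  shows "finite {y \<in> beta_integers b. 0 \<le> y \<and> y \<le> x}"
proof -
  obtain N where N: "x < b ^ N" using assms real_arch_pow by blast
  let ?W = "PiE {..<N} (\<lambda>_. {0..\<lceil>b\<rceil>})"
  have "y \<in> (\<lambda>e. \<Sum>i<N. of_int (e i) * b ^ i) ` ?W"
    if y: "y \<in> beta_integers b" "0 \<le> y" "y \<le> x" for y
  proof -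
    obtain k e where e: "\<And>i. 0 \<le> e i" "\<And>i. of_int (e i) < b" "y = (\<Sum>i<k. of_int (e i) * b ^ i)"
      using beta_integer_digits[OF y(1,2)] by metis
    have high: "e i = 0" if "i < k" "i \<ge> N" for i
    proof (rule ccontr)
      assume "e i \<noteq> 0"
      then have "1 \<le> e i" using e(1)[of i] by simp
      then have "b ^ N \<le> of_int (e i) * b ^ i"
        using \<open>i \<ge> N\<close> assms mult_mono[of 1 "real_of_int (e i)" "b ^ N" "b ^ i"]
        by (simp add: power_increasing)
      also have "\<dots> \<le> y" unfolding e(3)
        using that assms e(1) by (intro member_le_sum) auto
      finally show False using N y(3) by simp
    qed
    let ?e = "restrict (\<lambda>i. if i < k then e i else 0) {..<N}"
    have "(\<Sum>i<N. of_int (?e i) * b ^ i) = (\<Sum>i\<in>{..<N} \<inter> {..<k}. of_int (e i) * b ^ i)"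
      by (rule sum.mono_neutral_cong_right) auto
    also have "\<dots> = y" unfolding e(3)
      by (rule sum.mono_neutral_left) (auto simp: high)
    finally have "y = (\<Sum>i<N. of_int (?e i) * b ^ i)" by simp
    moreover have "?e \<in> ?W"
    proof (rule restrict_PiE_iff[THEN iffD2], rule ballI)
      fix i
      have "e i \<le> \<lceil>b\<rceil>" using e(2)[of i] by linarith
      then show "(if i < k then e i else 0) \<in> {0..\<lceil>b\<rceil>}" using e(1)[of i] assms by auto
    qed
    ultimately show ?thesis by (rule image_eqI)
  qed
  then have "{y \<in> beta_integers b. 0 \<le> y \<and> y \<le> x} \<subseteq> (\<lambda>e. \<Sum>i<N. of_int (e i) * b ^ i) ` ?W"
    by blast
  then show ?thesis by (rule finite_subset) (intro finite_imageI finite_PiE; simp)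
qed

text \<open>The greatest element in the definition of the integer part exists by finiteness, and it is within
  distance \<open>1\<close> of \<open>x\<close> because the greedy algorithm produces some \<open>\<beta>\<close>-integer that is.\<close>

lemma beta_floor:
  assumes "b > 1" "0 \<le> x"
  shows "beta_floor b x \<in> beta_integers b" "0 \<le> beta_floor b x" "beta_floor b x \<le> x"
    "x < beta_floor b x + 1" "\<And>y. y \<in> beta_integers b \<Longrightarrow> y \<le> x \<Longrightarrow> y \<le> beta_floor b x"
proof -
  let ?S = "{y \<in> beta_integers b. 0 \<le> y \<and> y \<le> x}"
  obtain z where z: "z \<in> ?S" "x < z + 1" using beta_integer_within_1[OF assms] by blast
  have fin: "finite ?S" using assms(1) by (rule finite_beta_integers_below)
  define m where "m = Max ?S"
  have m: "m \<in> ?S" unfolding m_def using fin z by (intro Max_in) auto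
  have max: "y \<le> m" if "y \<in> beta_integers b" "y \<le> x" for y
  proof (cases "0 \<le> y")
    case True
    then show ?thesis unfolding m_def using fin that by (intro Max_ge) auto
  next
    case False
    then show ?thesis using m by simp
  qed
  have "beta_floor b x = m"
    unfolding beta_floor_def by (rule Greatest_equality) (use m max in auto)
  moreover have "z \<le> m" using max z by simp
  ultimately show "beta_floor b x \<in> beta_integers b" "0 \<le> beta_floor b x" "beta_floor b x \<le> x"
    "x < beta_floor b x + 1" "\<And>y. y \<in> beta_integers b \<Longrightarrow> y \<le> x \<Longrightarrow> y \<le> beta_floor b x"
    using m max z by auto
qed

section \<open>Bases that are smaller than their conjugate\<close>

locale large_conjugate = real_quadratic +
  assumes base_gt_1: "1 < \<beta>" and conj_gt_base: "\<beta> < of_int t - \<beta>"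
begin

text \<open>Conjugation replaces the powers of \<open>\<beta>\<close> by the larger powers of \<open>t - \<beta>\<close> and keeps the digits. A
  non-zero digit at a position \<open>i \<ge> 1\<close> therefore makes the conjugate strictly larger, and already
  contributes \<open>t - \<beta>\<close>. Without such a digit only the lowest one remains.\<close>

lemma beta_integer_conj:
  assumes "y \<in> beta_integers \<beta>" "0 \<le> y"
  shows "y \<in> quad_order"
    and "(y \<in> \<int> \<and> y < \<beta>) \<or> (y < quad_conj \<beta> y \<and> of_int t - \<beta> \<le> quad_conj \<beta> y)"
proof -
  let ?\<beta>' = "of_int t - \<beta>"
  obtain k e where e: "\<And>i. 0 \<le> e i" "\<And>i. of_int (e i) < \<beta>"
    and y: "y = (\<Sum>i<k. of_int (e i) * \<beta> ^ i)"
    using beta_integer_digits[OF assms] by metis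
  have pw: "\<beta> ^ i \<in> quad_order \<and> quad_conj \<beta> (\<beta> ^ i) = ?\<beta>' ^ i" for i
    by (induction i) (auto simp: quad_order_1 quad_order_generator quad_order_mult conj_mult quad_order_subset
        conj_generator)
  have monomial: "of_int (e i) * \<beta> ^ i \<in> quad_order"
    "quad_conj \<beta> (of_int (e i) * \<beta> ^ i) = of_int (e i) * ?\<beta>' ^ i" for i
    using pw[of i] by (auto simp: quad_order_mult quad_order_Ints conj_mult quad_order_subset)
  have sums: "(\<Sum>i<m. of_int (e i) * \<beta> ^ i) \<in> quad_order
      \<and> quad_conj \<beta> (\<Sum>i<m. of_int (e i) * \<beta> ^ i) = (\<Sum>i<m. of_int (e i) * ?\<beta>' ^ i)" for m
    by (induction m) (auto simp: quad_order_0 quad_order_add monomial conj_add quad_order_subset)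
  show "y \<in> quad_order" using sums y by simp
  have conj: "quad_conj \<beta> y = (\<Sum>i<k. of_int (e i) * ?\<beta>' ^ i)" using sums y by simp
  show "(y \<in> \<int> \<and> y < \<beta>) \<or> (y < quad_conj \<beta> y \<and> ?\<beta>' \<le> quad_conj \<beta> y)"
  proof (cases "\<exists>i<k. i \<ge> 1 \<and> e i \<noteq> 0")
    case True
    then obtain i where i: "i < k" "i \<ge> 1" "e i \<noteq> 0" by blast
    then have ei: "1 \<le> real_of_int (e i)" using e(1)[of i] by linarith
    have "y < quad_conj \<beta> y" unfolding conj unfolding y
    proof (rule sum_strict_mono_ex1)
      show "\<forall>i\<in>{..<k}. of_int (e i) * \<beta> ^ i \<le> of_int (e i) * ?\<beta>' ^ i"
        using e(1) base_gt_1 conj_gt_base by (auto intro!: mult_left_mono power_mono)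
      have "of_int (e i) * \<beta> ^ i < of_int (e i) * ?\<beta>' ^ i"
        using ei i base_gt_1 conj_gt_base by (intro mult_strict_left_mono power_strict_mono) auto
      then show "\<exists>i\<in>{..<k}. of_int (e i) * \<beta> ^ i < of_int (e i) * ?\<beta>' ^ i" using i by blast
    qed simp
    moreover have "?\<beta>' \<le> quad_conj \<beta> y"
    proof -
      have "?\<beta>' ^ 1 \<le> ?\<beta>' ^ i" using i base_gt_1 conj_gt_base by (intro power_increasing) auto
      then have "1 * ?\<beta>' \<le> of_int (e i) * ?\<beta>' ^ i"
        using ei base_gt_1 conj_gt_base by (intro mult_mono) auto
      also have "\<dots> \<le> quad_conj \<beta> y" unfolding conj
        using i e(1) base_gt_1 conj_gt_base by (intro member_le_sum) auto
      finally show ?thesis by simp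
    qed
    ultimately show ?thesis by blast
  next
    case False
    have "y = (\<Sum>i<k. if i = 0 then of_int (e 0) else 0)"
      unfolding y using False by (intro sum.cong) auto
    then have "y = (if k = 0 then 0 else of_int (e 0))" by (simp add: sum.delta)
    then show ?thesis using e base_gt_1 by auto
  qed
qed

lemma beta_integer_le_conj:
  assumes "y \<in> beta_integers \<beta>" "0 \<le> y"
  shows "y \<le> quad_conj \<beta> y"
  using beta_integer_conj(2)[OF assms] Ints_subset_Rats by (auto simp: less_imp_le)

text \<open>The analogue of a reduced quadratic irrationality in the theory of ordinary continued
  fractions.\<close>

definition reduced :: "real \<Rightarrow> bool" where
  "reduced x \<longleftrightarrow> x \<in> rat_adjoin \<beta> \<and> 1 < x \<and> quad_conj \<beta> x \<in> {-1<..<0}"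

lemma reduced_not_beta_integer:
  assumes "reduced x"
  shows "x \<notin> beta_integers \<beta>"
  using beta_integer_le_conj[of x] assms by (auto simp: reduced_def)

text \<open>The new number exceeds \<open>1\<close> because the fractional part lies strictly between \<open>0\<close> and \<open>1\<close>. Its
  conjugate lies in the required interval because the conjugate of the integer part is at least the
  integer part and hence at least \<open>1\<close>.\<close>

lemma reduced_step:
  assumes "reduced x"
  shows "1 \<le> beta_floor \<beta> x" "reduced (1 / (x - beta_floor \<beta> x))"
    "quad_conj \<beta> (1 / (x - beta_floor \<beta> x)) = 1 / (quad_conj \<beta> x - quad_conj \<beta> (beta_floor \<beta> x))"
    "x - beta_floor \<beta> x \<noteq> 0"
proof -
  let ?a = "beta_floor \<beta> x"
  have x: "x \<in> rat_adjoin \<beta>" "1 < x" "quad_conj \<beta> x < 0" "- 1 < quad_conj \<beta> x" "0 \<le> x"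
    using assms by (auto simp: reduced_def)
  note a = beta_floor[OF base_gt_1 \<open>0 \<le> x\<close>]
  show a1: "1 \<le> ?a" using a(5) beta_integer_1[OF base_gt_1] x by simp
  have aK: "?a \<in> rat_adjoin \<beta>" using beta_integer_conj(1)[OF a(1,2)] by (rule quad_order_subset)
  have "?a \<noteq> x" using reduced_not_beta_integer[OF assms] a(1) by auto
  then have frac: "0 < x - ?a" "x - ?a < 1" using a by auto
  then show "x - ?a \<noteq> 0" by simp
  have K: "x - ?a \<in> rat_adjoin \<beta>" using x aK by (intro rat_adjoin_diff)
  show conj: "quad_conj \<beta> (1 / (x - ?a)) = 1 / (quad_conj \<beta> x - quad_conj \<beta> ?a)"
    using conj_inverse[OF K] conj_diff[OF x(1) aK] by (simp add: inverse_eq_divide)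
  have "quad_conj \<beta> x - quad_conj \<beta> ?a < - 1"
    using beta_integer_le_conj[OF a(1,2)] a1 x by simp
  then have "quad_conj \<beta> (1 / (x - ?a)) \<in> {-1<..<0}" unfolding conj by (auto simp: field_simps)
  then show "reduced (1 / (x - ?a))"
    using rat_adjoin_inverse[OF K] frac by (simp add: reduced_def inverse_eq_divide)
qed

lemma reduced_bcf_quotient:
  assumes "reduced x"
  shows "\<exists>y. bcf_quotient \<beta> x k = Some y \<and> reduced y"
  by (induction k) (use assms reduced_step(2) reduced_not_beta_integer in auto)

text \<open>A hypothetical period is first seen to consist of ordinary integers below \<open>\<beta>\<close>, then extended
  backwards, integrality included, to the index \<open>0\<close>; there it contradicts \<open>a 0 \<ge> \<beta>\<close>.\<close>

lemma reduced_aperiodic: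
  assumes "reduced \<xi>" "\<beta> < \<xi>"
  shows "bcf_aperiodic \<beta> \<xi>"
proof -
  define x where "x n = the (bcf_quotient \<beta> \<xi> n)" for n
  define a where "a n = beta_floor \<beta> (x n)" for n
  have q: "bcf_quotient \<beta> \<xi> n = Some (x n)" and red: "reduced (x n)" for n
    using reduced_bcf_quotient[OF assms(1), of n] by (auto simp: x_def)
  have digit: "bcf_digit \<beta> \<xi> n = Some (a n)" for n by (simp add: bcf_digit_def q a_def)
  have infinite: "\<not> bcf_finite \<beta> \<xi>" by (simp add: bcf_finite_def digit)
  have Suc: "x (Suc n) = 1 / (x n - a n)" for n
    using q[of "Suc n"] q[of n] reduced_not_beta_integer[OF red] by (simp add: a_def)
  have x: "x n \<in> rat_adjoin \<beta>" "1 < x n" "0 \<le> x n" "- 1 < quad_conj \<beta> (x n)" "quad_conj \<beta> (x n) < 0" for n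
    using red[of n] by (auto simp: reduced_def)
  have a: "1 \<le> a n" "a n \<in> beta_integers \<beta>" "0 \<le> a n" for n
    using reduced_step(1)[OF red] beta_floor[OF base_gt_1 x(3)] by (auto simp: a_def)
  have rec: "x n = a n + 1 / x (Suc n)" for n
    using Suc[of n] reduced_step(4)[OF red[of n]] by (simp add: a_def)
  have conj_rec: "quad_conj \<beta> (x n) - quad_conj \<beta> (a n) = 1 / quad_conj \<beta> (x (Suc n))" for n
    using reduced_step(3)[OF red[of n]] by (simp add: a_def Suc)
  have "\<not> bcf_eventually_periodic \<beta> \<xi>"
  proof
    assume "bcf_eventually_periodic \<beta> \<xi>"
    then obtain p N where p: "p > 0" and per: "\<And>n. n \<ge> N \<Longrightarrow> a (n + p) = a n"
      by (auto simp: bcf_eventually_periodic_def digit)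
    have x_per: "x (m + p) = x m" if "m \<ge> N" for m
    proof -
      have "x (m + p + 0) = x (m + 0)"
      proof (rule complete_quotient_unique[of "\<lambda>i. x (m + p + i)" "\<lambda>i. a (m + i)" "\<lambda>i. x (m + i)"])
        fix i
        show "x (m + p + i) = a (m + i) + 1 / x (m + p + Suc i)"
          using rec[of "m + p + i"] per[of "m + i"] that by (simp add: ac_simps)
        show "x (m + i) = a (m + i) + 1 / x (m + Suc i)" using rec[of "m + i"] by simp
      qed (use x(2) a(1) in auto)
      then show ?thesis by simp
    qed
    have int: "a m \<in> \<int> \<and> a m < \<beta>" if "m \<ge> N" for m
    proof -
      have "quad_conj \<beta> (a (m + 0)) = a (m + 0)"
      proof (rule conj_fixes_periodic_partial_quotients[of "\<lambda>i. x (m + i)" "\<lambda>i. a (m + i)" p])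
        fix i
        show "x (m + i) \<noteq> 0" using x(2)[of "m + i"] by simp
        show "x (m + i) = a (m + i) + 1 / x (m + Suc i)" using rec[of "m + i"] by simp
        show "a (m + i) \<in> quad_order" using beta_integer_conj(1) a by blast
        show "a (m + i) \<le> quad_conj \<beta> (a (m + i))" using beta_integer_le_conj a by blast
      qed (use x(1) a(1) p x_per[OF that] in auto)
      then show ?thesis using beta_integer_conj(2)[OF a(2,3)[of m]] by auto
    qed
    have "\<forall>m\<ge>0. x (m + p) = x m \<and> a m \<in> \<int> \<and> a m < \<beta>"
    proof (rule inc_induct[of 0 N])
      show "\<forall>m\<ge>N. x (m + p) = x m \<and> a m \<in> \<int> \<and> a m < \<beta>" using x_per int by blast
    next
      fix k assume IH: "\<forall>m\<ge>Suc k. x (m + p) = x m \<and> a m \<in> \<int> \<and> a m < \<beta>"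
      have ap: "a (k + p) \<in> \<int>" "a (k + p) < \<beta>" using IH p by auto
      then have conj_ap: "quad_conj \<beta> (a (k + p)) = a (k + p)" using Ints_subset_Rats by auto
      have "x (Suc k + p) = x (Suc k)" using IH by blast
      \<comment> \<open>The conjugated recursion has the same right-hand side at \<open>k\<close> and at \<open>k + p\<close>.\<close>
      then have eq: "quad_conj \<beta> (x k) - quad_conj \<beta> (a k) = quad_conj \<beta> (x (k + p)) - a (k + p)"
        using conj_rec[of k] conj_rec[of "k + p"] conj_ap by simp
      \<comment> \<open>The conjugates of \<open>x k\<close> and \<open>x (k + p)\<close> differ by less than \<open>1\<close>, and \<open>t - \<beta>\<close> exceeds \<open>\<beta> + 1\<close>.\<close>
      have "quad_conj \<beta> (a k) < of_int t - \<beta>"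
        using eq x(4,5)[of k] x(4,5)[of "k + p"] ap conj_gap[OF conj_gt_base] by linarith
      then have ak: "a k \<in> \<int>" "a k < \<beta>" using beta_integer_conj(2)[OF a(2,3)[of k]] by auto
      then have "quad_conj \<beta> (a k) = a k" using Ints_subset_Rats by auto
      then have "\<bar>a k - a (k + p)\<bar> < 1" using eq x(4,5)[of k] x(4,5)[of "k + p"] by linarith
      then have "a k = a (k + p)" using ak ap Ints_eq_abs_less1 by blast
      then have "x (k + p) = x k"
        using rec[of k] rec[of "k + p"] \<open>x (Suc k + p) = x (Suc k)\<close> by simp
      then show "\<forall>m\<ge>k. x (m + p) = x m \<and> a m \<in> \<int> \<and> a m < \<beta>"
        using IH ak by (metis Suc_leI le_neq_implies_less)
    qed simp
    then have "a 0 < \<beta>" by blast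
    moreover have "x 0 = \<xi>" by (simp add: x_def)
    moreover have "\<beta> \<le> a 0"
      unfolding a_def using beta_integer_base[OF base_gt_1] assms(2) \<open>x 0 = \<xi>\<close>
      by (intro beta_floor(5)[OF base_gt_1 x(3)]) auto
    ultimately show False by simp
  qed
  then show ?thesis using infinite by (simp add: bcf_aperiodic_def)
qed

text \<open>For \<open>z = \<lfloor>m (t - \<beta>)\<rfloor>\<close> the number \<open>z - m \<beta>\<close> has its conjugate in \<open>(-1, 0)\<close>, and it exceeds
  \<open>m ((t - \<beta>) - \<beta>) - 1\<close>, which is large for large \<open>m\<close>.\<close>

lemma ex_reduced_gt_base: "\<exists>\<xi>. reduced \<xi> \<and> \<beta> < \<xi>"
proof -
  let ?\<beta>' = "of_int t - \<beta>"
  obtain m :: nat where m: "(\<beta> + 1) / (?\<beta>' - \<beta>) < real m" using reals_Archimedean2 by blast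
  then have big: "\<beta> + 1 < real m * (?\<beta>' - \<beta>)" using conj_gt_base by (simp add: field_simps)
  define z where "z = \<lfloor>real m * ?\<beta>'\<rfloor>"
  have "m \<noteq> 0" using big base_gt_1 by (intro notI) simp
  have "of_int z \<noteq> real m * ?\<beta>'"
  proof
    assume "of_int z = real m * ?\<beta>'"
    then have "?\<beta>' = of_int z / of_nat m" using \<open>m \<noteq> 0\<close> by (simp add: field_simps)
    then show False using irrational_conj by (metis Rats_divide Rats_of_int Rats_of_nat)
  qed
  then have z: "real m * ?\<beta>' - 1 < of_int z" "of_int z < real m * ?\<beta>'"
    unfolding z_def by linarith+
  define \<xi> where "\<xi> = of_int z + (- real m) * \<beta>"
  have conj: "quad_conj \<beta> \<xi> = of_int z + (- real m) * ?\<beta>'"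
    unfolding \<xi>_def by (rule quad_conj_coordinates) auto
  have "\<beta> < \<xi>" using big z by (simp add: \<xi>_def algebra_simps)
  moreover have "\<xi> \<in> rat_adjoin \<beta>" unfolding \<xi>_def by (rule rat_adjoinI) auto
  moreover have "quad_conj \<beta> \<xi> \<in> {-1<..<0}" unfolding conj using z by simp
  ultimately have "reduced \<xi> \<and> \<beta> < \<xi>" using base_gt_1 by (simp add: reduced_def)
  then show ?thesis ..
qed

end

theorem theorem6p10:
  fixes \<beta> :: real
  assumes "\<beta> > 1"
    and "quadratic_integer \<beta>"
    and "quad_conj \<beta> \<beta> > \<beta>"
  shows "(\<forall>\<xi>\<in>rat_adjoin \<beta>.
            \<xi> > \<beta> \<and> quad_conj \<beta> \<xi> \<in> {-1<..<0} \<longrightarrow> bcf_aperiodic \<beta> \<xi>)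
         \<and> \<not> CFF \<beta> \<and> \<not> CFP \<beta>"
proof -
  obtain t n where "\<beta> * \<beta> = of_int t * \<beta> - of_int n"
    using quadratic_integer_monic[OF assms(2)] by blast
  then interpret real_quadratic \<beta> t n
    using quadratic_integer_irrational[OF assms(2)] by unfold_locales
  interpret large_conjugate \<beta> t n
    using assms(1,3) by unfold_locales (simp_all add: conj_generator)
  have aperiodic: "bcf_aperiodic \<beta> \<xi>"
    if "\<xi> \<in> rat_adjoin \<beta>" "\<beta> < \<xi>" "quad_conj \<beta> \<xi> \<in> {-1<..<0}" for \<xi>
    using that assms(1) by (intro reduced_aperiodic) (auto simp: reduced_def)
  moreover obtain \<xi> where "\<xi> \<in> rat_adjoin \<beta>" "bcf_aperiodic \<beta> \<xi>"
    using ex_reduced_gt_base reduced_aperiodic reduced_def by blast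
  ultimately show ?thesis by (auto simp: CFF_def CFP_def bcf_aperiodic_def)
qed

end
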